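(* Let $0<\alpha_2<\alpha_1<1$, $c_1,c_2\ge0$, $c_1+c_2=1$. For $n\ge1$ and $1\le s\le k$, the Laplace transform $\tilde p_{n,s}^{\alpha_1,\alpha_2}(z)=\int_0^\infty e^{-zt}p_{n,s}^{\alpha_1,\alpha_2}(t)\,\mathrm dt$, $z>0$, of the state probabilities of the mixed time-changed Erlang queue $\{\mathcal Q^{\alpha_1,\alpha_2}(t)\}_{t\ge0}$ is $$\tilde p_{n,s}^{\alpha_1,\alpha_2}(z)=(c_1z^{\alpha_1-1}+c_2z^{\alpha_2-1})\Big(\sum_{i=0}^\infty\frac{B_i^{n,s}}{\Theta(z)^{\delta_i^{n,s}}}+\sum_{i=0}^\infty\sum_{m=1}^\infty\sum_{r=0}^\infty\frac{C^{n,s}_{i,m,r}}{\Theta(z)^{\nu^{n,s}_{i,m,r}}}-\sum_{i=0}^\infty\sum_{m=1}^\infty\sum_{r=0}^\infty\frac{D^{n,s}_{i,m,r}}{\Theta(z)^{\pi^{n,s}_{i,m,r}}}\Big),$$ where $\Theta(z)=\lambda+k\mu+c_1z^{\alpha_1}+c_2z^{\alpha_2}$ and the constants $B,C,D,\delta,\nu,\pi$ are those defined in the context.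
   Context: Parameters: $\lambda>0$, $\mu>0$, $k\in\mathbb N=\{1,2,\dots\}$. Erlang queue: single-server queue with Poisson arrivals of rate $\lambda$, each service consisting of $k$ successive phases, each exponential with parameter $k\mu$, all independent. $\mathcal Q(t)=(\mathcal N(t),\mathcal S(t))$, where $\mathcal N(t)$ is the number of customers in the system and $\mathcal S(t)$ is the phase of the customer being served if $\mathcal N(t)>0$ (phases are counted down: service starts at phase $k$ and ends upon completion of phase $1$), with $\mathcal S(t)=0$ if $\mathcal N(t)=0$. Thus $\mathcal Q$ is the continuous-time Markov chain on $\mathcal H_0=\mathcal H\cup\{(0,0)\}$, $\mathcal H=\{(n,s)\in\mathbb N\times\mathbb N: s\le k\}$, with $\mathcal Q(0)=(0,0)$ and transition rates: $(0,0)\to(1,k)$ at rate $\lambda$; $(n,s)\to(n+1,s)$ at rate $\lambda$; $(n,s)\to(n,s-1)$ at rate $k\mu$ if $s\ge2$; $(n,1)\to(n-1,k)$ at rate $k\mu$ if $n\ge2$; $(1,1)\to(0,0)$ at rate $k\mu$. Inverse mixed stable subordinator: $\{D_{\alpha_1,\alpha_2}(t)\}_{t\ge0}$ is the nondecreasing Lévy process (started at $0$) with $\mathbb E(e^{-zD_{\alpha_1,\alpha_2}(t)})=e^{-t(c_1z^{\alpha_1}+c_2z^{\alpha_2})}$, $z>0$; $Y_{\alpha_1,\alpha_2}(t)=\inf\{s\ge0:D_{\alpha_1,\alpha_2}(s)>t\}$, $t>0$, $Y_{\alpha_1,\alpha_2}(0)=0$. Mixed time-changed Erlang queue: $\mathcal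 Q^{\alpha_1,\alpha_2}(t)=\mathcal Q(Y_{\alpha_1,\alpha_2}(t))$, with $\mathcal Q$ and $Y_{\alpha_1,\alpha_2}$ independent. State probabilities: $p_{n,s}^{\alpha_1,\alpha_2}(t)=\Pr(\mathcal Q^{\alpha_1,\alpha_2}(t)=(n,s)\mid \mathcal Q^{\alpha_1,\alpha_2}(0)=(0,0))$, $(n,s)\in\mathcal H$. Constants: $a^0_{m,r}=m+r(k+1)$, $A^0_{m,r}=\frac{m\lambda^r(k\mu)^{m+rk-1}}{r!\,(m+rk)!}(m+r(k+1)-1)!$; $B_i^{n,s}=\frac{\lambda^{n+i}(k\mu)^{k(i+1)-s}}{(k(i+1)-s)!\,(n+i)!}(n+k-s+i(k+1))!$; $\delta_i^{n,s}=n-s+(i+1)(k+1)$; $C^{n,s}_{i,m,r}=k\mu B_i^{n,s}A^0_{m,r}$; $\nu^{n,s}_{i,m,r}=\delta_i^{n,s}+a^0_{m,r}$; $D^{n,s}_{i,m,r}=k\mu B_i^{n,s+1}A^0_{m,r}$ for $s=1,\dots,k-1$ and $D^{n,k}_{i,m,r}=k\mu B_i^{n+1,1}A^0_{m,r}$; $\pi^{n,s}_{i,m,r}=\delta_i^{n,s+1}+a^0_{m,r}$ for $s=1,\dots,k-1$ and $\pi^{n,k}_{i,m,r}=\delta_i^{n+1,1}+a^0_{m,r}$. *)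

theory Defs
  imports "HOL-Probability.Probability"
begin

section \<open>Continuous-time Markov chains with given transition rates\<close>

text \<open>A stochastic semigroup on the countable state space \<open>S\<close>.\<close>

definition transition_function :: "'s set \<Rightarrow> (real \<Rightarrow> 's \<Rightarrow> 's \<Rightarrow> real) \<Rightarrow> bool" where
  "transition_function S p \<longleftrightarrow>
     (\<forall>t\<ge>0. \<forall>i\<in>S. \<forall>j\<in>S. 0 \<le> p t i j) \<and>
     (\<forall>t\<ge>0. \<forall>i\<in>S. (p t i has_sum 1) S) \<and>
     (\<forall>i\<in>S. \<forall>j\<in>S. p 0 i j = of_bool (i = j)) \<and>
     (\<forall>s\<ge>0. \<forall>t\<ge>0. \<forall>i\<in>S. \<forall>j\<in>S. ((\<lambda>l. p s i l * p t l j) has_sum p (s + t) i j) S)"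

text \<open>Only the off-diagonal values of \<open>q\<close> are used: \<open>q i j\<close> is the rate of the transition
  \<open>i \<rightarrow> j\<close> for \<open>i \<noteq> j\<close>. The rates are meant to be nonnegative with summable rows.\<close>

definition generator :: "'s set \<Rightarrow> ('s \<Rightarrow> 's \<Rightarrow> real) \<Rightarrow> 's \<Rightarrow> 's \<Rightarrow> real" where
  "generator S q i j = (if i = j then - (\<Sum>\<^sub>\<infinity>l\<in>S - {i}. q i l) else q i j)"

text \<open>Since \<open>p 0 i j = of_bool (i = j)\<close>, the derivative condition is the infinitesimal description
  \<open>p h i j = of_bool (i = j) + h * generator S q i j + o(h)\<close> as \<open>h\<close> decreases to \<open>0\<close>.
  The last condition says that the paths are right-continuous in the discrete topology
  of \<open>S\<close>, as is the convention for jump processes.\<close>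

definition ctmc ::
  "'w measure \<Rightarrow> 's set \<Rightarrow> ('s \<Rightarrow> 's \<Rightarrow> real) \<Rightarrow> 's \<Rightarrow> (real \<Rightarrow> 'w \<Rightarrow> 's) \<Rightarrow> bool" where
  "ctmc M S q x0 X \<longleftrightarrow>
     countable S \<and>
     (\<forall>t\<ge>0. X t \<in> measurable M (count_space S)) \<and>
     (AE \<omega> in M. X 0 \<omega> = x0) \<and>
     (\<exists>p. transition_function S p \<and>
        (\<forall>i\<in>S. \<forall>j\<in>S.
           ((\<lambda>h. p h i j) has_real_derivative generator S q i j) (at_right 0)) \<and>
        (\<forall>(m::nat) (t::nat \<Rightarrow> real) (x::nat \<Rightarrow> 's).
           0 \<le> t 0 \<longrightarrow> (\<forall>l\<le>m. t l < t (Suc l)) \<longrightarrow> (\<forall>l\<le>Suc m. x l \<in> S) \<longrightarrow>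
           \<P>(\<omega> in M. \<forall>l\<le>m. X (t l) \<omega> = x l) > 0 \<longrightarrow>
           \<P>(\<omega> in M. X (t (Suc m)) \<omega> = x (Suc m) \<bar> \<forall>l\<le>m. X (t l) \<omega> = x l)
             = p (t (Suc m) - t m) (x m) (x (Suc m)))) \<and>
     (\<forall>\<omega>\<in>space M. \<forall>t\<ge>0. eventually (\<lambda>u. X u \<omega> = X t \<omega>) (at_right t))"


section \<open>The Erlang queue\<close>

definition erlang_states :: "nat \<Rightarrow> (nat \<times> nat) set" where
  "erlang_states k = insert (0, 0) {(n, s). 1 \<le> n \<and> 1 \<le> s \<and> s \<le> k}"

definition erlang_rate :: "real \<Rightarrow> real \<Rightarrow> nat \<Rightarrow> nat \<times> nat \<Rightarrow> nat \<times> nat \<Rightarrow> real" where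
  "erlang_rate lam mu k = (\<lambda>(n, s) y.
     if (n, s) = (0, 0) then (if y = (1, k) then lam else 0)
     else if y = (n + 1, s) then lam
     else if s \<ge> 2 \<and> y = (n, s - 1) then real k * mu
     else if s = 1 \<and> n \<ge> 2 \<and> y = (n - 1, k) then real k * mu
     else if s = 1 \<and> n = 1 \<and> y = (0, 0) then real k * mu
     else 0)"

definition erlang_queue ::
  "'w measure \<Rightarrow> real \<Rightarrow> real \<Rightarrow> nat \<Rightarrow> (real \<Rightarrow> 'w \<Rightarrow> nat \<times> nat) \<Rightarrow> bool" where
  "erlang_queue M lam mu k Q \<longleftrightarrow> ctmc M (erlang_states k) (erlang_rate lam mu k) (0, 0) Q"


section \<open>The mixed stable subordinator and its inverse\<close>

definition levy_process :: "'w measure \<Rightarrow> (real \<Rightarrow> 'w \<Rightarrow> real) \<Rightarrow> bool" where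
  "levy_process M X \<longleftrightarrow>
     (\<forall>t\<ge>0. X t \<in> borel_measurable M) \<and>
     (AE \<omega> in M. X 0 \<omega> = 0) \<and>
     (\<forall>(m::nat) (t::nat \<Rightarrow> real). 0 \<le> t 0 \<longrightarrow> (\<forall>l<m. t l \<le> t (Suc l)) \<longrightarrow>
        prob_space.indep_vars M (\<lambda>_. borel) (\<lambda>l \<omega>. X (t (Suc l)) \<omega> - X (t l) \<omega>) {..<m}) \<and>
     (\<forall>s\<ge>0. \<forall>t\<ge>0. distr M borel (\<lambda>\<omega>. X (s + t) \<omega> - X s \<omega>) = distr M borel (X t)) \<and>
     (\<forall>\<omega>\<in>space M. \<forall>t\<ge>0. ((\<lambda>u. X u \<omega>) \<longlongrightarrow> X t \<omega>) (at_right t)) \<and>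
     (\<forall>\<omega>\<in>space M. \<forall>t>0. \<exists>L. ((\<lambda>u. X u \<omega>) \<longlongrightarrow> L) (at_left t))"

definition mixed_stable_subordinator ::
  "'w measure \<Rightarrow> real \<Rightarrow> real \<Rightarrow> real \<Rightarrow> real \<Rightarrow> (real \<Rightarrow> 'w \<Rightarrow> real) \<Rightarrow> bool" where
  "mixed_stable_subordinator M \<alpha>1 \<alpha>2 c1 c2 D \<longleftrightarrow>
     levy_process M D \<and>
     (\<forall>\<omega>\<in>space M. mono_on {0..} (\<lambda>t. D t \<omega>)) \<and>
     (\<forall>t\<ge>0. \<forall>z>0. prob_space.expectation M (\<lambda>\<omega>. exp (- z * D t \<omega>))
        = exp (- t * (c1 * z powr \<alpha>1 + c2 * z powr \<alpha>2)))"

text \<open>The set \<open>{s. 0 \<le> s \<and> t < D s \<omega>}\<close> is nonempty almost surely; the value \<open>0\<close> on the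
  exceptional null event only serves to keep the inverse a real-valued random variable.\<close>

definition inverse_subordinator :: "(real \<Rightarrow> 'w \<Rightarrow> real) \<Rightarrow> real \<Rightarrow> 'w \<Rightarrow> real" where
  "inverse_subordinator D t \<omega> =
     (if t = 0 \<or> {s. 0 \<le> s \<and> t < D s \<omega>} = {} then 0 else Inf {s. 0 \<le> s \<and> t < D s \<omega>})"


section \<open>Time change, state probabilities and Laplace transforms\<close>

definition process_events :: "'w measure \<Rightarrow> 'a measure \<Rightarrow> (real \<Rightarrow> 'w \<Rightarrow> 'a) \<Rightarrow> 'w set set" where
  "process_events M N X = sigma_sets (space M) {X t -` A \<inter> space M | t A. 0 \<le> t \<and> A \<in> sets N}"

definition indep_processes ::
  "'w measure \<Rightarrow> 'a measure \<Rightarrow> (real \<Rightarrow> 'w \<Rightarrow> 'a) \<Rightarrow> 'b measure \<Rightarrow> (real \<Rightarrow> 'w \<Rightarrow> 'b) \<Rightarrow> bool" where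
  "indep_processes M N1 X1 N2 X2 \<longleftrightarrow>
     prob_space.indep_set M (process_events M N1 X1) (process_events M N2 X2)"

definition time_change ::
  "(real \<Rightarrow> 'w \<Rightarrow> 's) \<Rightarrow> (real \<Rightarrow> 'w \<Rightarrow> real) \<Rightarrow> real \<Rightarrow> 'w \<Rightarrow> 's" where
  "time_change X Y t \<omega> = X (Y t \<omega>) \<omega>"

definition state_probability ::
  "'w measure \<Rightarrow> (real \<Rightarrow> 'w \<Rightarrow> nat \<times> nat) \<Rightarrow> nat \<Rightarrow> nat \<Rightarrow> real \<Rightarrow> real" where
  "state_probability M X n s t = \<P>(\<omega> in M. X t \<omega> = (n, s) \<bar> X 0 \<omega> = (0, 0))"

definition laplace_transform :: "(real \<Rightarrow> real) \<Rightarrow> real \<Rightarrow> real" where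
  "laplace_transform f z = (LINT t:{0..}|lborel. exp (- z * t) * f t)"


section \<open>The constants\<close>

text \<open>The subtractions are on natural numbers; none of them truncates when
  \<open>1 \<le> m\<close>, \<open>1 \<le> n\<close> and \<open>1 \<le> s \<le> k\<close>.\<close>

definition a0 :: "nat \<Rightarrow> nat \<Rightarrow> nat \<Rightarrow> nat" where
  "a0 k m r = m + r * (k + 1)"

definition A0 :: "real \<Rightarrow> real \<Rightarrow> nat \<Rightarrow> nat \<Rightarrow> nat \<Rightarrow> real" where
  "A0 lam mu k m r =
     real m * lam ^ r * (real k * mu) ^ (m + r * k - 1) / (fact r * fact (m + r * k))
       * fact (m + r * (k + 1) - 1)"

definition B_const :: "real \<Rightarrow> real \<Rightarrow> nat \<Rightarrow> nat \<Rightarrow> nat \<Rightarrow> nat \<Rightarrow> real" where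
  "B_const lam mu k n s i =
     lam ^ (n + i) * (real k * mu) ^ (k * (i + 1) - s) / (fact (k * (i + 1) - s) * fact (n + i))
       * fact (n + k - s + i * (k + 1))"

definition delta_const :: "nat \<Rightarrow> nat \<Rightarrow> nat \<Rightarrow> nat \<Rightarrow> nat" where
  "delta_const k n s i = n + (i + 1) * (k + 1) - s"

definition C_const :: "real \<Rightarrow> real \<Rightarrow> nat \<Rightarrow> nat \<Rightarrow> nat \<Rightarrow> nat \<Rightarrow> nat \<Rightarrow> nat \<Rightarrow> real" where
  "C_const lam mu k n s i m r = real k * mu * B_const lam mu k n s i * A0 lam mu k m r"

definition nu_const :: "nat \<Rightarrow> nat \<Rightarrow> nat \<Rightarrow> nat \<Rightarrow> nat \<Rightarrow> nat \<Rightarrow> nat" where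
  "nu_const k n s i m r = delta_const k n s i + a0 k m r"

definition D_const :: "real \<Rightarrow> real \<Rightarrow> nat \<Rightarrow> nat \<Rightarrow> nat \<Rightarrow> nat \<Rightarrow> nat \<Rightarrow> nat \<Rightarrow> real" where
  "D_const lam mu k n s i m r =
     (if s < k then real k * mu * B_const lam mu k n (s + 1) i * A0 lam mu k m r
      else real k * mu * B_const lam mu k (n + 1) 1 i * A0 lam mu k m r)"

definition pi_const :: "nat \<Rightarrow> nat \<Rightarrow> nat \<Rightarrow> nat \<Rightarrow> nat \<Rightarrow> nat \<Rightarrow> nat" where
  "pi_const k n s i m r =
     (if s < k then delta_const k n (s + 1) i + a0 k m r
      else delta_const k (n + 1) 1 i + a0 k m r)"

definition Theta :: "real \<Rightarrow> real \<Rightarrow> nat \<Rightarrow> real \<Rightarrow> real \<Rightarrow> real \<Rightarrow> real \<Rightarrow> real \<Rightarrow> real" where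
  "Theta lam mu k \<alpha>1 \<alpha>2 c1 c2 z = lam + real k * mu + c1 * z powr \<alpha>1 + c2 * z powr \<alpha>2"

end

theory Submission
  imports Defs
begin

text \<open>Let \<open>\<phi> = c1 * z powr \<alpha>1 + c2 * z powr \<alpha>2\<close>, and let \<open>Y\<close> be the inverse of the subordinator. At an
  independent exponential time of rate \<open>z\<close> the variable \<open>Y\<close> is exponential of rate \<open>\<phi>\<close>, hence the
  Laplace transform of the time-changed queue at \<open>z\<close> is \<open>\<phi> / z\<close> times that of the Erlang queue at
  \<open>\<phi>\<close>. The rates of the Erlang queue are bounded, so the latter solves the resolvent equation.
  Counting the remaining phases \<open>L = (n - 1) * k + s\<close> turns the queue into a walk on the naturals
  with jumps \<open>L \<rightarrow> L + k\<close> and \<open>L \<rightarrow> L - 1\<close>, reflected at \<open>0\<close>. Its resolvent is a combination of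
  two shifts of the Green function \<open>G\<close> of the free walk, which has the \<open>B\<close>-series as values. The
  coefficient is \<open>x / (1 - x)\<close>, where \<open>x\<close> is the discounted weight of the first passage one level
  down; the ballot-number series over \<open>A\<^sup>0\<close> with parameter \<open>m\<close> sums to \<open>x ^ m\<close>.\<close>

text \<open>Let \<open>P\<close> be the resolvent of the queue as a function of \<open>L\<close>,
  extended by zero to the integers. A step of the free walk from \<open>0\<close> to
  \<open>-1\<close> is a service completion that an empty queue cannot make. The weight
  \<open>c = b * P 0\<close> of these steps is removed at \<open>-1\<close> and returned at
  \<open>0\<close>, so \<open>P L = G L + c * (G L - G (L + 1))\<close>; these three terms are the
  \<open>B\<close>-, \<open>C\<close>- and \<open>D\<close>-series. The condition
  \<open>P (-1) = 0\<close> fixes \<open>c = x / (1 - x)\<close>, and the geometric series of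
  \<open>x\<close> over \<open>m \<ge> 1\<close> is the source of the index \<open>m\<close>.

  No path is ever counted. The explicit weights are checked against recurrences, and a bounded
  solution of these is determined by its sources and boundary value because
  \<open>T = lam + real k * mu + \<phi>\<close> exceeds the sum of the jump rates. On the
  probabilistic side the chain is given by its semigroup and the right derivatives at time
  \<open>0\<close>; bounded rates supply the domination that turns these into the resolvent equation
  on infinitely many states.\<close>

section \<open>Uniqueness of bounded solutions, and a bound on binomial weights\<close>

text \<open>Each use of the inequality improves a uniform bound by the factor
  \<open>(a + b) / T < 1\<close>. The maps \<open>f\<close> and \<open>g\<close> are left arbitrary
  so that it serves walks both on the naturals and on the integers.\<close>

lemma contraction_imp_zero:
  fixes d :: "'a \<Rightarrow> real"
  assumes "\<And>x. \<bar>d x\<bar> \<le> K" "0 \<le> a" "0 \<le> b" "a + b < T"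
    and "\<And>x. T * \<bar>d x\<bar> \<le> a * \<bar>d (f x)\<bar> + b * \<bar>d (g x)\<bar>"
  shows "d x = 0"
proof -
  define \<rho> where "\<rho> = (a + b) / T"
  have T: "T > 0" using assms by linarith
  have \<rho>: "0 \<le> \<rho>" "\<rho> < 1" using assms T by (auto simp: \<rho>_def)
  have bound: "\<bar>d x\<bar> \<le> K * \<rho> ^ n" for n x
  proof (induction n arbitrary: x)
    case 0
    show ?case using assms(1) by simp
  next
    case (Suc n)
    have "T * \<bar>d x\<bar> \<le> a * (K * \<rho> ^ n) + b * (K * \<rho> ^ n)"
      using assms(5)[of x] mult_left_mono[OF Suc[of "f x"] assms(2)] mult_left_mono[OF Suc[of "g x"] assms(3)]
      by linarith
    then have "\<bar>d x\<bar> \<le> (a + b) * (K * \<rho> ^ n) / T"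
      using T by (simp add: field_simps)
    then show ?case by (simp add: \<rho>_def ac_simps)
  qed
  have "(\<lambda>n. K * \<rho> ^ n) \<longlonglongrightarrow> K * 0"
    using \<rho> by (intro tendsto_mult tendsto_const LIMSEQ_power_zero) auto
  then have "\<bar>d x\<bar> \<le> K * 0"
    by (rule LIMSEQ_le_const) (use bound in auto)
  then show ?thesis by simp
qed

lemma binomial_term_le:
  fixes a b :: real
  assumes "0 \<le> a" "0 \<le> b"
  shows "real ((r + j) choose r) * a ^ r * b ^ j \<le> (a + b) ^ (r + j)"
proof -
  have "real ((r + j) choose r) * a ^ r * b ^ (r + j - r)
      \<le> (\<Sum>i\<le>r + j. real ((r + j) choose i) * a ^ i * b ^ (r + j - i))"
    by (rule member_le_sum) (use assms in auto)
  then show ?thesis by (simp add: binomial_ring)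
qed

section \<open>A discounted skip-free walk\<close>

text \<open>Total weight of the paths with \<open>r\<close> jumps up and \<open>j\<close> steps
  down: the binomial coefficient counts their orders, and each of the \<open>r + j + 1\<close>
  visits, the last included, costs a factor \<open>1 / T\<close>.\<close>

definition walk_weight :: "real \<Rightarrow> real \<Rightarrow> real \<Rightarrow> nat \<Rightarrow> nat \<Rightarrow> real" where
  "walk_weight a b T r j = real ((r + j) choose r) * a ^ r * b ^ j / T ^ (r + j + 1)"

text \<open>Decomposition by the last step; the fourth equation is Pascal's rule. The boundary cases
  stand apart because there one kind of last step is impossible.\<close>

lemma walk_weight_rec:
  assumes "T \<noteq> 0"
  shows "T * walk_weight a b T 0 0 = 1"
    and "T * walk_weight a b T (Suc r) 0 = a * walk_weight a b T r 0"
    and "T * walk_weight a b T 0 (Suc j) = b * walk_weight a b T 0 j"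
    and "T * walk_weight a b T (Suc r) (Suc j)
      = a * walk_weight a b T r (Suc j) + b * walk_weight a b T (Suc r) j"
  using assms by (simp_all add: walk_weight_def field_simps)

text \<open>The part of the Green function from \<open>0\<close> to \<open>L\<close> due to paths
  with exactly \<open>r\<close> jumps up: these must make \<open>r * k - L\<close> steps down, and
  there are none if that number is negative.\<close>

definition walk_green_term :: "real \<Rightarrow> real \<Rightarrow> real \<Rightarrow> nat \<Rightarrow> int \<Rightarrow> nat \<Rightarrow> real" where
  "walk_green_term a b T k L r =
     (if L \<le> int (r * k) then walk_weight a b T r (nat (int (r * k) - L)) else 0)"

definition walk_green :: "real \<Rightarrow> real \<Rightarrow> real \<Rightarrow> nat \<Rightarrow> int \<Rightarrow> real" where
  "walk_green a b T k L = (\<Sum>r. walk_green_term a b T k L r)"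

text \<open>The ballot number \<open>m / N * (N choose r)\<close> with \<open>N = m + r * (k + 1)\<close> counts the paths from \<open>m\<close> with
  \<open>r\<close> jumps up that first reach \<open>0\<close> after \<open>N\<close> steps. For \<open>m = r = 0\<close> its form with factorials gives \<open>0\<close> instead of \<open>1\<close>.\<close>

definition passage_term :: "real \<Rightarrow> real \<Rightarrow> real \<Rightarrow> nat \<Rightarrow> nat \<Rightarrow> nat \<Rightarrow> real" where
  "passage_term a b T k m r = (if m = 0 then of_bool (r = 0) else
     real m * fact (m + r * (k + 1) - 1) / (fact r * fact (m + r * k))
       * a ^ r * b ^ (m + r * k) / T ^ (m + r * (k + 1)))"

definition passage :: "real \<Rightarrow> real \<Rightarrow> real \<Rightarrow> nat \<Rightarrow> nat \<Rightarrow> real" where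
  "passage a b T k m = (\<Sum>r. passage_term a b T k m r)"

locale discounted_walk =
  fixes a b T :: real and k :: nat
  assumes pos: "0 < a" "0 < b" "a + b < T"
begin

abbreviation "g \<equiv> walk_green_term a b T k"
abbreviation "G \<equiv> walk_green a b T k"

abbreviation "\<rho> \<equiv> (a + b) / T"

lemma T_pos: "T > 0" and \<rho>: "0 \<le> \<rho>" "\<rho> < 1"
  using pos by auto

text \<open>The bound does not depend on \<open>j\<close>, so the series over \<open>r\<close>
  converges uniformly in the endpoint and the Green function is bounded on all integers.\<close>

lemma walk_weight_bound:
  "0 \<le> walk_weight a b T r j" "walk_weight a b T r j \<le> \<rho> ^ r / T"
proof -
  show "0 \<le> walk_weight a b T r j"
    using pos T_pos by (simp add: walk_weight_def)
  have "walk_weight a b T r j \<le> (a + b) ^ (r + j) / T ^ (r + j + 1)"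
    unfolding walk_weight_def
    by (intro divide_right_mono binomial_term_le) (use pos T_pos in auto)
  also have "\<dots> = \<rho> ^ (r + j) / T"
    by (simp add: power_divide)
  also have "\<dots> \<le> \<rho> ^ r / T"
    using \<rho> T_pos by (intro divide_right_mono power_decreasing) auto
  finally show "walk_weight a b T r j \<le> \<rho> ^ r / T" .
qed

lemma walk_green_term_bound: "0 \<le> g L r" "g L r \<le> \<rho> ^ r / T"
  using walk_weight_bound \<rho> T_pos by (auto simp: walk_green_term_def)

lemma rho_power_sums: "(\<lambda>r. \<rho> ^ r / T) sums (1 / (1 - \<rho>) / T)"
  using \<rho> by (intro sums_divide geometric_sums) auto

lemma summable_walk_green_term: "summable (g L)"
  by (rule summable_comparison_test'[OF sums_summable[OF rho_power_sums], of 0])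
     (use walk_green_term_bound in auto)

lemma walk_green_bound: "0 \<le> G L" "G L \<le> 1 / (1 - \<rho>) / T"
proof -
  show "0 \<le> G L"
    unfolding walk_green_def by (intro suminf_nonneg summable_walk_green_term walk_green_term_bound)
  show "G L \<le> 1 / (1 - \<rho>) / T"
    unfolding walk_green_def sums_unique[OF rho_power_sums]
    by (intro suminf_le walk_green_term_bound summable_walk_green_term sums_summable[OF rho_power_sums])
qed

lemma walk_green_0_pos: "G 0 > 0"
proof -
  have "g 0 0 \<le> G 0"
    using sum_le_suminf[OF summable_walk_green_term, of "{0}" 0] walk_green_term_bound by (simp add: walk_green_def)
  moreover have "g 0 0 > 0"
    using T_pos by (simp add: walk_green_term_def walk_weight_def)
  ultimately show ?thesis by linarith
qed

lemma walk_green_term_rec_0: "T * g L 0 = b * g (L + 1) 0 + of_bool (L = 0)"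
proof (cases "L \<le> 0")
  case True
  then obtain j where j: "L = - int j"
    by (metis nonpos_int_cases)
  show ?thesis
    using T_pos
    by (cases j) (simp_all add: j walk_green_term_def walk_weight_rec nat_add_distrib)
qed (simp add: walk_green_term_def)

lemma walk_green_term_rec_Suc: "T * g L (Suc r) = b * g (L + 1) (Suc r) + a * g (L - int k) r"
proof (cases "L \<le> int (Suc r * k)")
  case True
  then obtain j where j: "int (Suc r * k) - L = int j"
    by (metis diff_ge_0_iff_ge nonneg_int_cases)
  then have L: "L = int (Suc r * k) - int j" by simp
  show ?thesis
  proof (cases j)
    \<comment> \<open>A path without steps down can only have arrived by a jump up; accordingly the
      term at \<open>L + 1\<close> is zero.\<close>
    case 0
    then show ?thesis
      using T_pos by (simp add: L walk_green_term_def walk_weight_rec)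
  next
    case (Suc i)
    have "nat (int (Suc r * k) - (L + 1)) = i" "nat (int (r * k) - (L - int k)) = Suc i"
      "nat (int (Suc r * k) - L) = Suc i" "L + 1 \<le> int (Suc r * k)" "L - int k \<le> int (r * k)"
      using j Suc by (simp_all add: algebra_simps)
    then show ?thesis
      using T_pos True unfolding walk_green_term_def
      by (simp only: if_True walk_weight_rec)
  qed
qed (auto simp: walk_green_term_def algebra_simps)

text \<open>Summation over the number of jumps. A last jump up lowers that number by one, which the
  index shift absorbs, and the unit source at \<open>0\<close> comes from the paths without
  jumps.\<close>

lemma walk_green_rec: "T * G L = b * G (L + 1) + a * G (L - int k) + of_bool (L = 0)"
proof -
  have "T * G L = T * g L 0 + (\<Sum>r. T * g L (Suc r))"
    unfolding walk_green_def suminf_split_head[OF summable_walk_green_term, of L, symmetric]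
    using summable_walk_green_term by (subst suminf_mult) (auto simp: summable_Suc_iff suminf_split_head algebra_simps)
  also have "(\<Sum>r. T * g L (Suc r)) = (\<Sum>r. b * g (L + 1) (Suc r)) + (\<Sum>r. a * g (L - int k) r)"
    unfolding walk_green_term_rec_Suc using summable_walk_green_term
    by (intro suminf_add[symmetric]) (auto intro!: summable_mult simp: summable_Suc_iff)
  also have "(\<Sum>r. a * g (L - int k) r) = a * G (L - int k)"
    unfolding walk_green_def by (intro suminf_mult summable_walk_green_term)
  also have "(\<Sum>r. b * g (L + 1) (Suc r)) = b * (G (L + 1) - g (L + 1) 0)"
    unfolding walk_green_def suminf_split_head[OF summable_walk_green_term, symmetric]
    using summable_walk_green_term by (intro suminf_mult) (auto simp: summable_Suc_iff)
  finally show ?thesis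
    by (simp add: walk_green_term_rec_0 algebra_simps)
qed

section \<open>First-passage weights of the free walk\<close>

abbreviation "f \<equiv> passage_term a b T k"
abbreviation "F \<equiv> passage a b T k"

text \<open>A ballot number is at most the binomial coefficient, since its factor
  \<open>m / N\<close> is at most \<open>1\<close>.\<close>

lemma passage_term_bound: "0 \<le> f m r" "f m r \<le> \<rho> ^ r"
proof -
  show "0 \<le> f m r"
    using pos T_pos by (simp add: passage_term_def)
  show "f m r \<le> \<rho> ^ r"
  proof (cases m)
    case (Suc m')
    define N where "N = r + (m + r * k)"
    have N: "m + r * (k + 1) = N" by (simp add: N_def)
    have "real m * fact (N - 1) \<le> real N * fact (N - 1)"
      by (intro mult_right_mono) (auto simp: N_def)
    also have "\<dots> = fact N"
      by (subst (2) fact_reduce) (auto simp: N_def Suc)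
    finally have "f m r \<le> fact N / (fact r * fact (m + r * k)) * a ^ r * b ^ (m + r * k) / T ^ N"
      unfolding passage_term_def N using Suc pos T_pos
      by (auto intro!: divide_right_mono mult_right_mono)
    also have "\<dots> = real (N choose r) * a ^ r * b ^ (m + r * k) / T ^ N"
      by (subst binomial_fact) (auto simp: N_def)
    also have "\<dots> \<le> (a + b) ^ N / T ^ N"
      unfolding N_def by (intro divide_right_mono binomial_term_le) (use pos T_pos in auto)
    also have "\<dots> = \<rho> ^ N" by (simp add: power_divide)
    also have "\<dots> \<le> \<rho> ^ r"
      using \<rho> by (intro power_decreasing) (auto simp: N_def)
    finally show ?thesis .
  qed (use \<rho> in \<open>auto simp: passage_term_def\<close>)
qed

lemma summable_passage_term: "summable (f m)"
  by (rule summable_comparison_test'[OF summable_geometric[of \<rho>], of 0])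
     (use passage_term_bound \<rho> in auto)

lemma passage_bound: "0 \<le> F m" "F m \<le> 1 / (1 - \<rho>)"
proof -
  show "0 \<le> F m"
    unfolding passage_def by (intro suminf_nonneg summable_passage_term passage_term_bound)
  have "F m \<le> (\<Sum>r. \<rho> ^ r)"
    unfolding passage_def
    by (intro suminf_le passage_term_bound summable_passage_term summable_geometric) (use \<rho> in auto)
  also have "\<dots> = 1 / (1 - \<rho>)"
    using \<rho> by (intro suminf_geometric) auto
  finally show "F m \<le> 1 / (1 - \<rho>)" .
qed

lemma passage_0: "F 0 = 1"
proof -
  have "f 0 = (\<lambda>r. of_bool (r = 0))"
    by (auto simp: passage_term_def)
  then show ?thesis
    using suminf_finite[of "{0}" "f 0"] by (simp add: passage_def)
qed

lemma passage_term_rec_0: "T * f (Suc m) 0 = b * f m 0"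
proof (cases m)
  case (Suc i)
  have "real (Suc n) * fact n / fact (Suc n) = (1::real)" for n
    by (subst fact_Suc) (simp del: of_nat_Suc)
  then show ?thesis
    using T_pos Suc by (simp add: passage_term_def del: of_nat_Suc fact_Suc)
qed (use T_pos in \<open>simp add: passage_term_def\<close>)

text \<open>Decomposition by the first step: from \<open>Suc m\<close> the walk moves down to
  \<open>m\<close>, or up to \<open>Suc m + k\<close> with one jump fewer to come.\<close>

lemma passage_term_rec_Suc: "T * f (Suc m) (Suc r) = b * f m (Suc r) + a * f (Suc m + k) r"
proof -
  define N where "N = m + r * (k + 1) + k"
  define J where "J = m + r * k + k"
  have e: "Suc m + Suc r * (k + 1) = Suc (Suc N)" "Suc m + Suc r * k = Suc J"
    "Suc m + k + r * (k + 1) = Suc N" "Suc m + k + r * k = Suc J"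
    "m + Suc r * (k + 1) = Suc N" "m + Suc r * k = J"
    by (simp_all add: N_def J_def)
  have 1: "f (Suc m) (Suc r)
      = real (Suc m) * fact (Suc N) / (fact (Suc r) * fact (Suc J)) * a ^ Suc r * b ^ Suc J / T ^ Suc (Suc N)"
    unfolding passage_term_def e by simp
  \<comment> \<open>The factor \<open>real m\<close> makes this correct also for
    \<open>m = 0\<close>, where a path that is already at \<open>0\<close> has no jumps to
    make.\<close>
  have 2: "f m (Suc r) = real m * fact N / (fact (Suc r) * fact J) * a ^ Suc r * b ^ J / T ^ Suc N"
    unfolding passage_term_def e by simp
  have 3: "f (Suc m + k) r
      = real (Suc m + k) * fact N / (fact r * fact (Suc J)) * a ^ r * b ^ Suc J / T ^ Suc N"
    unfolding passage_term_def e by simp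
  \<comment> \<open>After extraction of the common factor \<open>c\<close> from the three terms this
    polynomial identity is all that remains of the recurrence.\<close>
  have id: "real (Suc m) * real (Suc N) = real m * real (Suc J) + real (Suc m + k) * real (Suc r)"
    unfolding N_def J_def by (simp add: algebra_simps)
  define c where "c = fact N * a ^ Suc r * b ^ Suc J / (fact (Suc r) * fact (Suc J) * T ^ Suc N)"
  have "T * f (Suc m) (Suc r) = (real (Suc m) * real (Suc N)) * c"
    unfolding 1 c_def fact_Suc[of N] using T_pos by (simp add: field_simps del: of_nat_Suc fact_Suc)
  moreover have "b * f m (Suc r) = (real m * real (Suc J)) * c"
    unfolding 2 c_def fact_Suc[of J] using T_pos by (simp add: field_simps del: of_nat_Suc fact_Suc)
  moreover have "a * f (Suc m + k) r = (real (Suc m + k) * real (Suc r)) * c"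
    unfolding 3 c_def fact_Suc[of r] using T_pos by (simp add: field_simps del: of_nat_Suc fact_Suc)
  ultimately show ?thesis
    unfolding id by (simp add: distrib_right)
qed

lemma passage_rec: "T * F (Suc m) = b * F m + a * F (Suc m + k)"
proof -
  have "T * F (Suc m) = T * f (Suc m) 0 + (\<Sum>r. T * f (Suc m) (Suc r))"
    unfolding passage_def suminf_split_head[OF summable_passage_term, of "Suc m", symmetric]
    using summable_passage_term by (subst suminf_mult) (auto simp: summable_Suc_iff suminf_split_head algebra_simps)
  also have "(\<Sum>r. T * f (Suc m) (Suc r)) = (\<Sum>r. b * f m (Suc r)) + (\<Sum>r. a * f (Suc m + k) r)"
    unfolding passage_term_rec_Suc using summable_passage_term
    by (intro suminf_add[symmetric]) (auto intro!: summable_mult simp: summable_Suc_iff)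
  also have "(\<Sum>r. a * f (Suc m + k) r) = a * F (Suc m + k)"
    unfolding passage_def by (intro suminf_mult summable_passage_term)
  also have "(\<Sum>r. b * f m (Suc r)) = b * (F m - f m 0)"
    unfolding passage_def suminf_split_head[OF summable_passage_term, symmetric]
    using summable_passage_term by (intro suminf_mult) (auto simp: summable_Suc_iff)
  finally show ?thesis
    by (simp add: passage_term_rec_0 algebra_simps)
qed

text \<open>First-step equation for the weight \<open>x\<close> of a descent by one level: after a
  jump up, \<open>Suc k\<close> levels are left to descend. The difference of the two sides is
  \<open>- b < 0\<close> at \<open>0\<close> and \<open>T - b - a > 0\<close> at
  \<open>1\<close>.\<close>

lemma root_exists: "\<exists>x. 0 < x \<and> x < 1 \<and> T * x = b + a * x ^ Suc k"
proof -
  define h where "h x = T * x - b - a * x ^ Suc k" for x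
  have "\<exists>x. 0 \<le> x \<and> x \<le> 1 \<and> h x = 0"
    by (rule IVT') (use pos in \<open>auto simp: h_def intro!: continuous_intros\<close>)
  then obtain x where "0 \<le> x" "x \<le> 1" "h x = 0" by blast
  moreover have "h 0 \<noteq> 0" "h 1 \<noteq> 0" using pos by (auto simp: h_def)
  ultimately show ?thesis
    by (intro exI[of _ x]) (auto simp: h_def less_le)
qed

text \<open>Both the first-passage weights and the Green function below the origin solve this
  recurrence.\<close>

lemma bounded_recurrence_eq_power:
  assumes x: "0 < x" "x < 1" "T * x = b + a * x ^ Suc k"
    and "\<And>m. \<bar>v m\<bar> \<le> K"
    and rec: "\<And>m. T * v (Suc m) = b * v m + a * v (Suc m + k)"
  shows "v m = v 0 * x ^ m"
proof -
  have "v m - v 0 * x ^ m = 0"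
  proof (rule contraction_imp_zero[of "\<lambda>m. v m - v 0 * x ^ m" "K + K" b a T "\<lambda>m. m - 1" "\<lambda>m. m + k"])
    fix m
    have "\<bar>v 0 * x ^ m\<bar> \<le> \<bar>v 0\<bar>"
      using x by (simp add: abs_mult mult_left_le power_le_one)
    then show "\<bar>v m - v 0 * x ^ m\<bar> \<le> K + K"
      using assms(4)[of m] assms(4)[of 0] by linarith
    \<comment> \<open>At \<open>m = 0\<close> the difference vanishes, so the truncated
      \<open>m - 1\<close> does no harm there.\<close>
    show "T * \<bar>v m - v 0 * x ^ m\<bar>
        \<le> b * \<bar>v (m - 1) - v 0 * x ^ (m - 1)\<bar> + a * \<bar>v (m + k) - v 0 * x ^ (m + k)\<bar>"
    proof (cases m)
      case (Suc i)
      have "T * x ^ Suc i = x ^ i * (b + a * x ^ Suc k)"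
        unfolding x(3)[symmetric] by simp
      also have "\<dots> = b * x ^ i + a * x ^ (Suc i + k)"
        by (simp add: algebra_simps power_add)
      finally have "T * (v m - v 0 * x ^ m)
        = b * (v i - v 0 * x ^ i) + a * (v (m + k) - v 0 * x ^ (m + k))"
      proof -
        have "T * (v m - v 0 * x ^ m) = T * v (Suc i) - v 0 * (T * x ^ Suc i)"
          by (simp add: Suc algebra_simps)
        also have "\<dots> = b * (v i - v 0 * x ^ i) + a * (v (m + k) - v 0 * x ^ (m + k))"
          unfolding Suc rec \<open>T * x ^ Suc i = _\<close> by (simp add: algebra_simps power_add)
        finally show ?thesis .
      qed
      then have "\<bar>T * (v m - v 0 * x ^ m)\<bar>
        \<le> \<bar>b * (v i - v 0 * x ^ i)\<bar> + \<bar>a * (v (m + k) - v 0 * x ^ (m + k))\<bar>"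
        by (simp add: abs_triangle_ineq)
      then show ?thesis using pos T_pos by (simp add: abs_mult Suc)
    qed (use pos in simp)
  qed (use pos in auto)
  then show ?thesis by simp
qed

text \<open>With \<open>F 0 = 1\<close> the recurrence forces \<open>F m = x ^ m\<close>, which
  leaves a geometric series without its first term.\<close>

lemma passage_sums:
  assumes "0 < x" "x < 1" "T * x = b + a * x ^ Suc k"
  shows "(\<lambda>m. F (Suc m)) sums (x / (1 - x))"
proof -
  have "\<bar>F m\<bar> \<le> 1 / (1 - \<rho>)" for m using passage_bound[of m] by simp
  then have "F (Suc m) = x * x ^ m" for m
    using bounded_recurrence_eq_power[OF assms _ passage_rec, of "1 / (1 - \<rho>)" "Suc m"] passage_0 by simp
  moreover have "(\<lambda>m. x * x ^ m) sums (x * (1 / (1 - x)))"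
    using assms by (intro sums_mult geometric_sums) auto
  ultimately show ?thesis by simp
qed

text \<open>The source at \<open>0\<close> is not seen from negative positions, so
  \<open>G (- int m)\<close> satisfies the first-passage recurrence in \<open>m\<close>.\<close>

lemma walk_green_minus_1:
  assumes "0 < x" "x < 1" "T * x = b + a * x ^ Suc k"
  shows "G (-1) = x * G 0"
proof -
  have rec: "T * G (- int (Suc m)) = b * G (- int m) + a * G (- int (Suc m + k))" for m
    using walk_green_rec[of "- int (Suc m)"] by (simp add: algebra_simps)
  have "\<bar>G L\<bar> \<le> 1 / (1 - \<rho>) / T" for L using walk_green_bound[of L] by simp
  then show ?thesis
    using bounded_recurrence_eq_power[OF assms _ rec, of "1 / (1 - \<rho>) / T" 1] by simp
qed

text \<open>Extending \<open>P\<close> by zero turns the reflection at \<open>0\<close> into the sources \<open>1 + b * P 0\<close> at \<open>0\<close>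
  and \<open>- b * P 0\<close> at \<open>-1\<close> of the free walk on the integers.\<close>

theorem reflected_resolvent:
  assumes bdd: "\<And>L. \<bar>P L\<bar> \<le> K" and neg: "\<And>L. L < 0 \<Longrightarrow> P L = 0"
    and P: "\<And>L. L \<ge> 0 \<Longrightarrow> T * P L = b * P (L + 1) + a * P (L - int k) + of_bool (L = 0) * (1 + b * P 0)"
  shows "P L = (1 + b * P 0) * G L - b * P 0 * G (L + 1)"
    and "(\<lambda>m. F (Suc m)) sums (b * P 0)"
proof -
  \<comment> \<open>Superposition of Green functions for the two sources; \<open>G (L + 1)\<close>
    is the one with its source at \<open>-1\<close>.\<close>
  define H where "H L = (1 + b * P 0) * G L - b * P 0 * G (L + 1)" for L
  have H: "T * H L = b * H (L + 1) + a * H (L - int k)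
      + (1 + b * P 0) * of_bool (L = 0) - b * P 0 * of_bool (L + 1 = 0)" for L
  proof -
    have "T * H L = (1 + b * P 0) * (T * G L) - b * P 0 * (T * G (L + 1))"
      by (simp add: H_def algebra_simps)
    also have "\<dots> = b * H (L + 1) + a * H (L - int k)
      + (1 + b * P 0) * of_bool (L = 0) - b * P 0 * of_bool (L + 1 = 0)"
      unfolding walk_green_rec H_def by (simp add: algebra_simps)
    finally show ?thesis .
  qed
  define B where "B = 1 / (1 - \<rho>) / T"
  have Hb: "\<bar>H L\<bar> \<le> (\<bar>1 + b * P 0\<bar> + \<bar>b * P 0\<bar>) * B" for L
  proof -
    have "\<bar>G L\<bar> \<le> B" for L using walk_green_bound[of L] by (simp add: B_def)
    then have "\<bar>(1 + b * P 0) * G L\<bar> \<le> \<bar>1 + b * P 0\<bar> * B" "\<bar>b * P 0 * G (L + 1)\<bar> \<le> \<bar>b * P 0\<bar> * B"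
      unfolding abs_mult[of "1 + b * P 0"] abs_mult[of "b * P 0"] by (auto intro!: mult_left_mono)
    then show ?thesis
      unfolding H_def distrib_right by linarith
  qed
  have "P L - H L = 0" for L
  proof (rule contraction_imp_zero[of "\<lambda>L. P L - H L" _ b a T "\<lambda>L. L + 1" "\<lambda>L. L - int k"])
    fix L
    show "\<bar>P L - H L\<bar> \<le> K + (\<bar>1 + b * P 0\<bar> + \<bar>b * P 0\<bar>) * B"
      using bdd[of L] Hb[of L] by linarith
    have "T * (P L - H L) = b * (P (L + 1) - H (L + 1)) + a * (P (L - int k) - H (L - int k))"
    proof (cases "L \<ge> 0")
      case True
      then show ?thesis using P[of L] H[of L] by (auto simp: algebra_simps)
    next
      case False
      \<comment> \<open>At \<open>-1\<close> the inflow \<open>b * P 0\<close> from above cancels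
        the negative source; further down every term of the equation for \<open>P\<close> is
        zero.\<close>
      then have "P (L - int k) = 0" "P L = 0" "L \<noteq> -1 \<longrightarrow> P (L + 1) = 0" using neg by auto
      then show ?thesis using False H[of L] by (cases "L = -1") (auto simp: algebra_simps)
    qed
    then have "\<bar>T * (P L - H L)\<bar>
        \<le> \<bar>b * (P (L + 1) - H (L + 1))\<bar> + \<bar>a * (P (L - int k) - H (L - int k))\<bar>"
      by (simp add: abs_triangle_ineq)
    then show "T * \<bar>P L - H L\<bar> \<le> b * \<bar>P (L + 1) - H (L + 1)\<bar> + a * \<bar>P (L - int k) - H (L - int k)\<bar>"
      using pos T_pos by (simp add: abs_mult)
  qed (use pos in auto)
  then have PH: "P L = H L" for L by simp
  show "P L = (1 + b * P 0) * G L - b * P 0 * G (L + 1)"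
    by (fact PH[unfolded H_def])
  obtain x where x: "0 < x" "x < 1" "T * x = b + a * x ^ Suc k"
    using root_exists by blast
  \<comment> \<open>Vanishing at \<open>-1\<close> is the boundary condition that determines the
    unknown \<open>b * P 0\<close>; the factor \<open>G 0\<close> can be cancelled as it is
    positive.\<close>
  have "H (-1) = 0" using neg[of "-1"] PH[of "-1"] by simp
  then have "((1 + b * P 0) * x - b * P 0) * G 0 = 0"
    using walk_green_minus_1[OF x] by (simp add: H_def left_diff_distrib ac_simps)
  then have "(1 + b * P 0) * x - b * P 0 = 0"
    using walk_green_0_pos by (metis less_irrefl mult_eq_0_iff)
  then have "b * P 0 * (1 - x) = x"
    by (simp add: algebra_simps)
  then have "b * P 0 = x / (1 - x)"
    using x by (subst eq_divide_eq) auto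
  then show "(\<lambda>m. F (Suc m)) sums (b * P 0)"
    using passage_sums[OF x] by simp
qed

end

section \<open>The resolvent of a chain with bounded rates\<close>

text \<open>Outside a finite set \<open>Y\<close> the sum of \<open>f h\<close> is at most the tail
  of \<open>B\<close>, uniformly in \<open>h\<close>. The limit in \<open>h\<close> is taken first,
  then \<open>Y\<close> grows.\<close>

lemma has_sum_tendsto_dominated:
  fixes f :: "'b \<Rightarrow> 'a \<Rightarrow> real"
  assumes F: "F \<noteq> bot"
    and s: "eventually (\<lambda>h. (f h has_sum s h) S) F" "(s \<longlongrightarrow> s0) F"
    and b: "\<And>l. l \<in> S \<Longrightarrow> ((\<lambda>h. f h l) \<longlongrightarrow> b l) F"
    and bound: "eventually (\<lambda>h. \<forall>l\<in>S. \<bar>f h l\<bar> \<le> B l) F"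
    and B: "(B has_sum t) S"
  shows "(b has_sum s0) S"
proof -
  have tail: "\<bar>s0 - sum b Y\<bar> \<le> t - sum B Y" if Y: "finite Y" "Y \<subseteq> S" for Y
  proof (rule tendsto_upperbound[OF _ _ F])
    show "((\<lambda>h. \<bar>s h - sum (f h) Y\<bar>) \<longlongrightarrow> \<bar>s0 - sum b Y\<bar>) F"
      using Y by (intro tendsto_intros s b) auto
    show "eventually (\<lambda>h. \<bar>s h - sum (f h) Y\<bar> \<le> t - sum B Y) F"
      using s(1) bound
    proof eventually_elim
      case (elim h)
      have 1: "(f h has_sum (s h - sum (f h) Y)) (S - Y)"
        using Y by (intro has_sum_Diff elim has_sum_finite) auto
      have 2: "(B has_sum (t - sum B Y)) (S - Y)"
        using Y by (intro has_sum_Diff B has_sum_finite) auto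
      have 3: "((\<lambda>l. - B l) has_sum - (t - sum B Y)) (S - Y)"
        using 2 by (rule has_sum_uminusI)
      have "s h - sum (f h) Y \<le> t - sum B Y"
        by (rule has_sum_mono[OF 1 2]) (use elim(2) in \<open>auto simp: abs_le_iff\<close>)
      moreover have "- (t - sum B Y) \<le> s h - sum (f h) Y"
        by (rule has_sum_mono[OF 3 1]) (use elim(2) in \<open>auto simp: abs_le_iff minus_le_iff\<close>)
      ultimately show ?case by linarith
    qed
  qed
  have "((\<lambda>Y. t - sum B Y) \<longlongrightarrow> t - t) (finite_subsets_at_top S)"
    using B unfolding has_sum_def by (intro tendsto_intros)
  then have "((\<lambda>Y. t - sum B Y) \<longlongrightarrow> 0) (finite_subsets_at_top S)"
    by simp
  then have "((\<lambda>Y. s0 - sum b Y) \<longlongrightarrow> 0) (finite_subsets_at_top S)"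
    by (rule Lim_null_comparison[rotated]) (rule eventually_finite_subsets_at_top_weakI, simp add: tail)
  from tendsto_diff[OF tendsto_const[of s0] this] show ?thesis
    by (simp add: has_sum_def)
qed

text \<open>For infinite \<open>S\<close> the summands are enumerated; being nonnegative, they have
  partial sums dominated by the total \<open>g\<close>.\<close>

lemma integral_has_sum:
  fixes f :: "'a \<Rightarrow> 'b \<Rightarrow> real"
  assumes S: "countable S"
    and f: "\<And>l. l \<in> S \<Longrightarrow> integrable N (f l)" "\<And>l x. l \<in> S \<Longrightarrow> x \<in> space N \<Longrightarrow> 0 \<le> f l x"
    and g: "integrable N g" "\<And>x. x \<in> space N \<Longrightarrow> ((\<lambda>l. f l x) has_sum g x) S"
  shows "((\<lambda>l. \<integral>x. f l x \<partial>N) has_sum (\<integral>x. g x \<partial>N)) S"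
proof (cases "finite S")
  case True
  have "(\<integral>x. g x \<partial>N) = (\<integral>x. (\<Sum>l\<in>S. f l x) \<partial>N)"
    by (intro Bochner_Integration.integral_cong refl has_sum_unique[OF g(2) has_sum_finite[OF True]])
  also have "\<dots> = (\<Sum>l\<in>S. \<integral>x. f l x \<partial>N)"
    by (intro Bochner_Integration.integral_sum f)
  finally show ?thesis using True by (simp add: has_sum_finite)
next
  case False
  define e where "e = from_nat_into S"
  have e: "bij_betw e UNIV S"
    unfolding e_def using S False by (rule bij_betw_from_nat_into)
  then have eS: "e n \<in> S" for n by (auto simp: bij_betw_def)
  have sums: "(\<lambda>n. f (e n) x) sums g x" if "x \<in> space N" for x
    by (rule has_sum_imp_sums[OF has_sum_reindex_bij_betw[OF e, THEN iffD2, OF g(2)[OF that]]])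
  have "(\<lambda>n. \<integral>x. (\<Sum>i<n. f (e i) x) \<partial>N) \<longlonglongrightarrow> (\<integral>x. g x \<partial>N)"
  proof (rule integral_dominated_convergence[where w = g])
    show "AE x in N. (\<lambda>n. \<Sum>i<n. f (e i) x) \<longlonglongrightarrow> g x"
      using sums by (auto simp: sums_def)
    show "AE x in N. norm (\<Sum>i<n. f (e i) x) \<le> g x" for n
    proof (rule AE_I2)
      fix x assume x: "x \<in> space N"
      have "(\<Sum>i<n. f (e i) x) \<le> g x"
        using sum_le_suminf[OF sums_summable[OF sums[OF x]], of "{..<n}"] sums_unique[OF sums[OF x]] f(2)[OF eS x]
        by simp
      then show "norm (\<Sum>i<n. f (e i) x) \<le> g x"
        using f(2)[OF eS x] by (simp add: sum_nonneg)
    qed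
  qed (use f(1)[OF eS] g(1) in auto)
  then have "(\<lambda>n. \<integral>x. f (e n) x \<partial>N) sums (\<integral>x. g x \<partial>N)"
    unfolding sums_def using f(1)[OF eS] by (subst (asm) Bochner_Integration.integral_sum) auto
  then have "((\<lambda>n. \<integral>x. f (e n) x \<partial>N) has_sum (\<integral>x. g x \<partial>N)) UNIV"
    by (rule sums_nonneg_imp_has_sum) (intro integral_nonneg_AE AE_I2 f(2)[OF eS])
  then show ?thesis
    by (rule has_sum_reindex_bij_betw[OF e, THEN iffD1])
qed

lemma set_integral_exp_minus:
  assumes "w > (0::real)"
  shows "set_integrable lborel {0..} (\<lambda>t. exp (- w * t))"
    and "(LINT t:{0..}|lborel. exp (- w * t)) = 1 / w"
proof -
  have i: "((\<lambda>t. exp (- w * t)) has_integral exp (- w * 0) / w) {0..}"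
    by (rule has_integral_exp_minus_to_infinity) fact
  then have "(\<lambda>t. exp (- w * t)) absolutely_integrable_on {0..}"
    by (intro nonnegative_absolutely_integrable_1) auto
  then show 1: "set_integrable lborel {0..} (\<lambda>t. exp (- w * t))"
    unfolding set_integrable_def by (simp add: integrable_completion)
  show "(LINT t:{0..}|lborel. exp (- w * t)) = 1 / w"
    using set_borel_integral_eq_integral(2)[OF 1] integral_unique[OF i] by simp
qed

lemma set_integrable_exp_mult:
  fixes g :: "real \<Rightarrow> real"
  assumes "w > 0" and [measurable]: "set_borel_measurable borel {0..} g" and "\<And>t. t \<ge> 0 \<Longrightarrow> \<bar>g t\<bar> \<le> K"
  shows "set_integrable lborel {0..} (\<lambda>t. exp (- w * t) * g t)"
proof (rule set_integrable_bound[OF set_integrable_mult_right[of K]])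
  show "set_integrable lborel {0..} (\<lambda>t. exp (- w * t))"
    by (rule set_integral_exp_minus) fact
  have [measurable]: "(\<lambda>t. indicator {0..} t * g t) \<in> borel_measurable borel"
    using assms(2) by (simp add: set_borel_measurable_def)
  have "(\<lambda>t. exp (- w * t) * (indicator {0..} t * g t)) \<in> borel_measurable borel" by measurable
  then show "set_borel_measurable lborel {0..} (\<lambda>t. exp (- w * t) * g t)"
    by (simp add: set_borel_measurable_def ac_simps)
  show "AE t in lborel. t \<in> {0..} \<longrightarrow> norm (exp (- w * t) * g t) \<le> norm (K * exp (- w * t))"
  proof (intro AE_I2 impI)
    fix t :: real assume "t \<in> {0..}"
    then have "\<bar>g t\<bar> \<le> \<bar>K\<bar>" using assms(3)[of t] by simp
    then show "norm (exp (- w * t) * g t) \<le> norm (K * exp (- w * t))"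
      by (simp add: abs_mult mult.commute)
  qed
qed

lemma set_integrable_exp_mult_continuous:
  fixes g :: "real \<Rightarrow> real"
  assumes "w > 0" "continuous_on {0..} g" "\<And>t. t \<ge> 0 \<Longrightarrow> \<bar>g t\<bar> \<le> K"
  shows "set_integrable lborel {0..} (\<lambda>t. exp (- w * t) * g t)"
  by (rule set_integrable_exp_mult[OF assms(1) _ assms(3)])
     (use borel_measurable_continuous_on_indicator[OF _ assms(2)] in \<open>auto simp: set_borel_measurable_def\<close>)

text \<open>The shift is moved from \<open>u\<close> into the kernel: the transform of
  \<open>u (t + h)\<close> is \<open>exp (w * h) * (L - I h)\<close>, where \<open>I h\<close> is
  the part of the integral over \<open>{0..h}\<close>. This is differentiable at \<open>0\<close> by
  continuity of \<open>u\<close> alone.\<close>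

lemma laplace_transform_shift_derivative:
  fixes u :: "real \<Rightarrow> real"
  assumes w: "w > 0" and u: "continuous_on {0..} u" "\<And>t. t \<ge> 0 \<Longrightarrow> \<bar>u t\<bar> \<le> K"
  shows "((\<lambda>h. (laplace_transform (\<lambda>t. u (t + h)) w - laplace_transform u w) / h)
    \<longlongrightarrow> w * laplace_transform u w - u 0) (at_right 0)"
proof -
  define v where "v t = exp (- w * t) * u t" for t
  define I where "I h = integral {0..h} v" for h
  define L where "L = laplace_transform u w"
  have v: "continuous_on {0..} v"
    unfolding v_def by (intro continuous_intros u)
  have vi: "set_integrable lborel {0..} v"
    unfolding v_def using set_integrable_exp_mult_continuous[OF w u] .
  have shift: "laplace_transform (\<lambda>t. u (t + h)) w = exp (w * h) * (L - I h)" if h: "h \<ge> 0" for h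
  proof -
    \<comment> \<open>The form \<open>h + 1 * t\<close> matches the affine substitution applied
      below.\<close>
    have "laplace_transform (\<lambda>t. u (t + h)) w
        = (\<integral>t. exp (w * h) * (indicator {h..} (h + 1 * t) * v (h + 1 * t)) \<partial>lborel)"
      unfolding laplace_transform_def set_lebesgue_integral_def v_def
    proof (intro Bochner_Integration.integral_cong refl)
      fix t :: real
      have "exp (w * h) * exp (- w * (h + 1 * t)) = exp (- w * t)"
        by (simp add: exp_add[symmetric] algebra_simps)
      then show "indicator {0..} t *\<^sub>R (exp (- w * t) * u (t + h))
          = exp (w * h) * (indicator {h..} (h + 1 * t) * (exp (- w * (h + 1 * t)) * u (h + 1 * t)))"
        by (cases "t \<ge> 0") (simp_all add: add.commute)
    qed
    also have "\<dots> = exp (w * h) * (\<integral>t. indicator {h..} (h + 1 * t) * v (h + 1 * t) \<partial>lborel)"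
      by (rule integral_mult_right_zero)
    also have "(\<integral>t. indicator {h..} (h + 1 * t) * v (h + 1 * t) \<partial>lborel) = (LINT t:{h..}|lborel. v t)"
      unfolding set_lebesgue_integral_def
      by (subst (2) lborel_integral_real_affine[of 1 _ h]) auto
    also have "(LINT t:{h..}|lborel. v t) = L - (LINT t:{0..<h}|lborel. v t)"
    proof -
      have "(LINT t:{0..<h} \<union> {h..}|lborel. v t) = (LINT t:{0..<h}|lborel. v t) + (LINT t:{h..}|lborel. v t)"
        using h by (intro set_integral_Un set_integrable_subset[OF vi]) auto
      moreover have "{0..<h} \<union> {h..} = {0..}" using h by auto
      ultimately show ?thesis by (simp add: L_def laplace_transform_def v_def)
    qed
    also have "(LINT t:{0..<h}|lborel. v t) = (LINT t:{0..h}|lborel. v t)"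
      unfolding set_lebesgue_integral_def
    proof (rule integral_cong_AE)
      show "AE t in lborel. indicat_real {0..<h} t *\<^sub>R v t = indicat_real {0..h} t *\<^sub>R v t"
        using AE_lborel_singleton[of h] by eventually_elim (auto simp: indicator_def)
      have "set_integrable lborel A v" if "A \<in> sets borel" "A \<subseteq> {0..}" for A
        using set_integrable_subset[OF vi] that by simp
      from this[of "{0..<h}"] this[of "{0..h}"]
      show "(\<lambda>t. indicat_real {0..<h} t *\<^sub>R v t) \<in> borel_measurable lborel"
        "(\<lambda>t. indicat_real {0..h} t *\<^sub>R v t) \<in> borel_measurable lborel"
        unfolding set_integrable_def by (force dest: borel_measurable_integrable)+
    qed
    also have "\<dots> = I h"
      unfolding I_def by (rule set_borel_integral_eq_integral) (rule set_integrable_subset[OF vi], auto)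
    finally show ?thesis .
  qed
  have "(I has_real_derivative v 0) (at 0 within {0..1})"
    unfolding I_def
    by (rule integral_has_real_derivative) (auto intro: continuous_on_subset[OF v])
  then have "(I has_real_derivative v 0) (at_right 0)"
    by (simp add: at_within_Icc_at_right)
  then have "((\<lambda>h. exp (w * h) * (L - I h)) has_real_derivative
      exp (w * 0) * w * (L - I 0) - exp (w * 0) * v 0) (at_right 0)"
    by (auto intro!: derivative_eq_intros)
  then have "((\<lambda>h. exp (w * h) * (L - I h)) has_real_derivative w * L - u 0) (at_right 0)"
    unfolding v_def by (simp add: I_def)
  then have "((\<lambda>h. (exp (w * h) * (L - I h) - L) / h) \<longlongrightarrow> w * L - u 0) (at_right 0)"
    by (simp add: has_field_derivative_iff I_def)
  moreover have "eventually (\<lambda>h. (exp (w * h) * (L - I h) - L) / h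
      = (laplace_transform (\<lambda>t. u (t + h)) w - L) / h) (at_right 0)"
    by (rule eventually_at_rightI[of 0 1]) (simp_all only: shift greaterThanLessThan_iff less_imp_le zero_less_one)
  ultimately show ?thesis
    unfolding L_def[symmetric] by (rule Lim_transform_eventually)
qed

section \<open>Transition functions with bounded exit rates and their resolvent equation\<close>

locale bounded_rate_chain =
  fixes S :: "'s set" and p :: "real \<Rightarrow> 's \<Rightarrow> 's \<Rightarrow> real" and q :: "'s \<Rightarrow> 's \<Rightarrow> real" and C :: real
  assumes countable: "countable S"
    and transition: "transition_function S p"
    and derivative: "\<And>i j. i \<in> S \<Longrightarrow> j \<in> S \<Longrightarrow>
      ((\<lambda>h. p h i j) has_real_derivative generator S q i j) (at_right 0)"
    and rate_le: "\<And>i. i \<in> S \<Longrightarrow> - generator S q i i \<le> C"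
    and C_nonneg: "0 \<le> C"
begin

lemma p_nonneg: "t \<ge> 0 \<Longrightarrow> i \<in> S \<Longrightarrow> j \<in> S \<Longrightarrow> 0 \<le> p t i j"
  and p_has_sum: "t \<ge> 0 \<Longrightarrow> i \<in> S \<Longrightarrow> (p t i has_sum 1) S"
  and p_0: "i \<in> S \<Longrightarrow> j \<in> S \<Longrightarrow> p 0 i j = of_bool (i = j)"
  and chapman_kolmogorov: "s \<ge> 0 \<Longrightarrow> t \<ge> 0 \<Longrightarrow> i \<in> S \<Longrightarrow> j \<in> S \<Longrightarrow>
    ((\<lambda>l. p s i l * p t l j) has_sum p (s + t) i j) S"
  using transition by (auto simp: transition_function_def)

lemma p_le_1: "t \<ge> 0 \<Longrightarrow> i \<in> S \<Longrightarrow> j \<in> S \<Longrightarrow> p t i j \<le> 1"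
  using finite_sum_le_has_sum[OF p_has_sum, of t i "{j}"] p_nonneg by auto

lemma p_mult_le:
  assumes "s \<ge> 0" "t \<ge> 0" "i \<in> S" "j \<in> S" "l \<in> S"
  shows "p s i l * p t l j \<le> p (s + t) i j"
  using finite_sum_le_has_sum[OF chapman_kolmogorov, of s t i j "{l}"] assms p_nonneg by auto

text \<open>The function \<open>1 - p t l l\<close> of \<open>t\<close> is subadditive, hence lies below its tangent at \<open>0\<close>.\<close>

lemma one_minus_p_diag_le:
  assumes l: "l \<in> S" and t: "t \<ge> 0"
  shows "1 - p t l l \<le> C * t"
proof (cases "t = 0")
  case False
  with t have t: "t > 0" by simp
  have mult: "1 - p (real m * s) l l \<le> real m * (1 - p s l l)" if "s \<ge> 0" for m s
  proof (induction m)
    case 0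
    show ?case using p_0 l by simp
  next
    case (Suc m)
    \<comment> \<open>Expanding this product is the subadditivity: the chain is in \<open>l\<close>
      after both pieces of time at least if it is there after each in turn.\<close>
    have "0 \<le> (1 - p s l l) * (1 - p (real m * s) l l)"
      using p_le_1 l that by simp
    then have "1 - p s l l * p (real m * s) l l \<le> (1 - p s l l) + (1 - p (real m * s) l l)"
      by (simp add: algebra_simps)
    moreover have "p s l l * p (real m * s) l l \<le> p (real (Suc m) * s) l l"
      using p_mult_le[of s "real m * s" l l l] that l by (simp add: algebra_simps)
    ultimately show ?case
      using Suc by (simp add: algebra_simps)
  qed
  have "((\<lambda>h. (p h l l - 1) / h) \<longlongrightarrow> generator S q l l) (at_right 0)"
    using derivative[OF l l] p_0[OF l l] by (simp add: has_field_derivative_iff)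
  \<comment> \<open>The interval of length \<open>t\<close> is cut into \<open>Suc m\<close> equal
    pieces, whose length tends to \<open>0\<close> from the right, where the derivative is
    known.\<close>
  moreover have "filterlim (\<lambda>m. t / real (Suc m)) (at_right 0) sequentially"
  proof (rule tendsto_imp_filterlim_at_right)
    show "(\<lambda>m. t / real (Suc m)) \<longlonglongrightarrow> 0"
      using tendsto_mult_left[OF LIMSEQ_inverse_real_of_nat, of t] by (simp add: divide_inverse)
  qed (use t in auto)
  ultimately have lim: "(\<lambda>m. (p (t / real (Suc m)) l l - 1) / (t / real (Suc m))) \<longlonglongrightarrow> generator S q l l"
    by (rule filterlim_compose)
  have "1 - p t l l \<le> - generator S q l l * t"
  proof (rule LIMSEQ_le_const[OF tendsto_mult_right[OF tendsto_minus[OF lim], of t]])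
    have "1 - p t l l \<le> - ((p (t / real (Suc m)) l l - 1) / (t / real (Suc m))) * t" for m
    proof -
      have "- ((p (t / real (Suc m)) l l - 1) / (t / real (Suc m))) * t
          = real (Suc m) * (1 - p (t / real (Suc m)) l l)"
        using t by (simp add: field_simps del: of_nat_Suc)
      moreover have "real (Suc m) * (t / real (Suc m)) = t" by simp
      ultimately show ?thesis
        using mult[of "t / real (Suc m)" "Suc m"] t by simp
    qed
    then show "\<exists>N. \<forall>m\<ge>N. 1 - p t l l \<le> - ((p (t / real (Suc m)) l l - 1) / (t / real (Suc m))) * t"
      by blast
  qed
  also have "\<dots> \<le> C * t"
    using rate_le[OF l] t by (intro mult_right_mono) auto
  finally show ?thesis .
qed (use p_0 l in simp)

lemma p_offdiag_le:
  assumes "l \<in> S" "j \<in> S" "l \<noteq> j" "t \<ge> 0"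
  shows "p t l j \<le> C * t"
proof -
  have "(\<Sum>i\<in>{l, j}. p t l i) \<le> 1"
    using assms by (intro finite_sum_le_has_sum[OF p_has_sum, of t l]) (auto intro: p_nonneg)
  then show ?thesis
    using one_minus_p_diag_le[of l t] assms by simp
qed

lemma p_increment_le:
  assumes "l \<in> S" "j \<in> S" "t \<ge> 0"
  shows "\<bar>p t l j - of_bool (l = j)\<bar> \<le> C * t"
  using assms one_minus_p_diag_le[of l t] p_offdiag_le[of l j t] p_le_1[of t l j] p_nonneg[of t l j]
  by (cases "l = j") auto

text \<open>Split at time \<open>t\<close> by the state \<open>l\<close> reached there. From above,
  \<open>l = j\<close> contributes at most \<open>p t i j\<close> and every other state at most
  \<open>p t i l * (C * h)\<close>; from below, the path through \<open>l = j\<close>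
  suffices.\<close>

lemma p_lipschitz:
  assumes t: "t \<ge> 0" "h \<ge> 0" and i: "i \<in> S" and j: "j \<in> S"
  shows "\<bar>p (t + h) i j - p t i j\<bar> \<le> C * h"
proof -
  have Ch: "C * h \<ge> 0" using C_nonneg t by simp
  have 1: "((\<lambda>l. (if l = j then p t i j else 0) + p t i l * (C * h)) has_sum (p t i j + 1 * (C * h))) S"
    using t i j by (intro has_sum_add has_sum_cmult_left p_has_sum has_sum_finite_neutralI[where B = "{j}"]) auto
  have "p (t + h) i j \<le> p t i j + 1 * (C * h)"
  proof (rule has_sum_mono[OF chapman_kolmogorov[OF t i j] 1])
    fix l assume l: "l \<in> S"
    show "p t i l * p h l j \<le> (if l = j then p t i j else 0) + p t i l * (C * h)"
      using p_offdiag_le[OF l j _ t(2)] p_nonneg[OF t(1) i l] p_le_1[OF t(2) j j] Ch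
      by (auto intro!: mult_left_mono add_increasing2 mult_left_le)
  qed
  moreover have "p t i j * (1 - p h j j) \<le> 1 * (C * h)"
    using t i j p_le_1 one_minus_p_diag_le Ch by (intro mult_mono) auto
  then have "p t i j - C * h \<le> p (t + h) i j"
    using p_mult_le[OF t i j j] by (simp add: algebra_simps)
  ultimately show ?thesis by linarith
qed

lemma p_continuous:
  assumes "i \<in> S" "j \<in> S"
  shows "continuous_on {0..} (\<lambda>t. p t i j)"
proof (rule lipschitz_on_continuous_on[OF lipschitz_onI[where L = C]])
  fix s t :: real assume st: "s \<in> {0..}" "t \<in> {0..}"
  show "dist (p s i j) (p t i j) \<le> C * dist s t"
    using p_lipschitz[of s "t - s" i j] p_lipschitz[of t "s - t" i j] assms st
    by (cases "s \<le> t") (auto simp: dist_real_def abs_minus_commute)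
qed (rule C_nonneg)

definition resolvent :: "real \<Rightarrow> 's \<Rightarrow> 's \<Rightarrow> real" where
  "resolvent w i j = laplace_transform (\<lambda>t. p t i j) w"

context
  fixes w :: real and i :: 's
  assumes w: "w > 0" and i: "i \<in> S"
begin

lemma p_integrable:
  assumes "j \<in> S" "h \<ge> 0"
  shows "set_integrable lborel {0..} (\<lambda>t. exp (- w * t) * p (t + h) i j)"
proof (rule set_integrable_exp_mult_continuous[OF w])
  show "continuous_on {0..} (\<lambda>t. p (t + h) i j)"
    by (rule continuous_on_compose2[OF p_continuous[OF i assms(1)]]) (use assms in \<open>auto intro!: continuous_intros\<close>)
  show "\<bar>p (t + h) i j\<bar> \<le> 1" if "t \<ge> 0" for t
    using p_nonneg p_le_1 assms i that by simp
qed

text \<open>The Chapman-Kolmogorov equation integrated over its first time argument against the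
  exponential kernel.\<close>

lemma laplace_has_sum:
  assumes "j \<in> S" "h \<ge> 0"
  shows "((\<lambda>l. resolvent w i l * p h l j) has_sum laplace_transform (\<lambda>t. p (t + h) i j) w) S"
proof -
  have "((\<lambda>l. LINT t|lborel. indicator {0..} t *\<^sub>R (exp (- w * t) * p t i l) * p h l j) has_sum
      (LINT t|lborel. indicator {0..} t *\<^sub>R (exp (- w * t) * p (t + h) i j))) S"
  proof (rule integral_has_sum[OF countable])
    fix l assume l: "l \<in> S"
    show "integrable lborel (\<lambda>t. indicator {0..} t *\<^sub>R (exp (- w * t) * p t i l) * p h l j)"
      using p_integrable[OF l, of 0] unfolding set_integrable_def by (intro integrable_mult_left) simp
    show "0 \<le> indicator {0..} t *\<^sub>R (exp (- w * t) * p t i l) * p h l j" for t :: real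
      using p_nonneg i l assms by (auto simp: indicator_def)
  next
    show "integrable lborel (\<lambda>t. indicator {0..} t *\<^sub>R (exp (- w * t) * p (t + h) i j))"
      using p_integrable[OF assms] unfolding set_integrable_def .
  next
    fix t :: real
    show "((\<lambda>l. indicator {0..} t *\<^sub>R (exp (- w * t) * p t i l) * p h l j) has_sum
        indicator {0..} t *\<^sub>R (exp (- w * t) * p (t + h) i j)) S"
      using has_sum_cmult_right[OF chapman_kolmogorov[of t h i j], of "exp (- w * t)"] i assms
      by (cases "t \<ge> 0") (auto simp: mult.assoc)
  qed
  then show ?thesis
    by (simp add: resolvent_def laplace_transform_def set_lebesgue_integral_def)
qed

lemma resolvent_has_sum: "(resolvent w i has_sum 1 / w) S"
proof -
  have "((\<lambda>l. LINT t|lborel. indicator {0..} t *\<^sub>R (exp (- w * t) * p t i l)) has_sum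
      (LINT t|lborel. indicator {0..} t *\<^sub>R exp (- w * t))) S"
  proof (rule integral_has_sum[OF countable])
    fix l assume l: "l \<in> S"
    show "integrable lborel (\<lambda>t. indicator {0..} t *\<^sub>R (exp (- w * t) * p t i l))"
      using p_integrable[OF l, of 0] unfolding set_integrable_def by simp
    show "0 \<le> indicator {0..} t *\<^sub>R (exp (- w * t) * p t i l)" for t :: real
      using p_nonneg i l by (auto simp: indicator_def)
  next
    show "integrable lborel (\<lambda>t. indicator {0..} t *\<^sub>R exp (- w * t))"
      using set_integral_exp_minus(1)[OF w] unfolding set_integrable_def .
  next
    fix t :: real
    show "((\<lambda>l. indicator {0..} t *\<^sub>R (exp (- w * t) * p t i l)) has_sum
        indicator {0..} t *\<^sub>R exp (- w * t)) S"
      using has_sum_cmult_right[OF p_has_sum[of t i], of "exp (- w * t)"] i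
      by (cases "t \<ge> 0") auto
  qed
  then show ?thesis
    using set_integral_exp_minus(2)[OF w]
    by (simp add: resolvent_def[abs_def] laplace_transform_def set_lebesgue_integral_def)
qed

lemma resolvent_nonneg: "j \<in> S \<Longrightarrow> 0 \<le> resolvent w i j"
  unfolding resolvent_def laplace_transform_def set_lebesgue_integral_def
  by (rule integral_nonneg_AE) (use p_nonneg i in \<open>auto simp: indicator_def\<close>)

lemma resolvent_le: "j \<in> S \<Longrightarrow> resolvent w i j \<le> 1 / w"
  using finite_sum_le_has_sum[OF resolvent_has_sum, of "{j}"] resolvent_nonneg by auto

text \<open>Subtracting the resolvent from \<open>laplace_has_sum\<close>, dividing by
  \<open>h\<close> and letting \<open>h\<close> decrease to \<open>0\<close> gives the forward
  equation in Laplace form. Domination comes from \<open>p_increment_le\<close>: the quotients are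
  at most \<open>C\<close>, and the resolvent row has the finite sum \<open>1 / w\<close>.\<close>

theorem resolvent_equation:
  assumes j: "j \<in> S"
  shows "((\<lambda>l. resolvent w i l * generator S q l j) has_sum (w * resolvent w i j - of_bool (i = j))) S"
proof (rule has_sum_tendsto_dominated)
  show "at_right (0::real) \<noteq> bot" by simp
  show "eventually (\<lambda>h. ((\<lambda>l. resolvent w i l * ((p h l j - of_bool (l = j)) / h)) has_sum
      ((laplace_transform (\<lambda>t. p (t + h) i j) w - laplace_transform (\<lambda>t. p t i j) w) / h)) S) (at_right 0)"
  proof (rule eventually_at_rightI[of 0 1])
    fix h :: real assume h: "h \<in> {0<..<1}"
    have "((\<lambda>l. if l = j then resolvent w i j else 0) has_sum resolvent w i j) S"
      using j by (intro has_sum_finite_neutralI[where B = "{j}"]) auto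
    then have "((\<lambda>l. (resolvent w i l * p h l j + - (if l = j then resolvent w i j else 0)) * (1 / h)) has_sum
      (laplace_transform (\<lambda>t. p (t + h) i j) w + - resolvent w i j) * (1 / h)) S"
      using h by (intro has_sum_cmult_left has_sum_add has_sum_uminusI laplace_has_sum j) auto
    then show "((\<lambda>l. resolvent w i l * ((p h l j - of_bool (l = j)) / h)) has_sum
      ((laplace_transform (\<lambda>t. p (t + h) i j) w - laplace_transform (\<lambda>t. p t i j) w) / h)) S"
      by (rule back_subst[of "\<lambda>x. x"])
         (intro arg_cong2[where f = "\<lambda>f x. (f has_sum x) S"] ext, auto simp: field_simps resolvent_def)
  qed simp
  show "((\<lambda>h. (laplace_transform (\<lambda>t. p (t + h) i j) w - laplace_transform (\<lambda>t. p t i j) w) / h)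
      \<longlongrightarrow> w * resolvent w i j - of_bool (i = j)) (at_right 0)"
    unfolding resolvent_def p_0[OF i j, symmetric]
    by (rule laplace_transform_shift_derivative[OF w p_continuous[OF i j], where K = 1])
       (use p_nonneg p_le_1 i j in auto)
  show "((\<lambda>h. resolvent w i l * ((p h l j - of_bool (l = j)) / h)) \<longlongrightarrow> resolvent w i l * generator S q l j)
      (at_right 0)" if "l \<in> S" for l
    using derivative[OF that j] p_0[OF that j] by (intro tendsto_mult_left) (simp add: has_field_derivative_iff)
  show "eventually (\<lambda>h. \<forall>l\<in>S. \<bar>resolvent w i l * ((p h l j - of_bool (l = j)) / h)\<bar> \<le> resolvent w i l * C)
      (at_right 0)"
  proof (rule eventually_at_rightI[of 0 1], intro ballI)
    fix h :: real and l assume "h \<in> {0<..<1}" and l: "l \<in> S"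
    then have "\<bar>(p h l j - of_bool (l = j)) / h\<bar> \<le> C"
      using p_increment_le[OF l j, of h] by (simp add: divide_le_eq)
    then show "\<bar>resolvent w i l * ((p h l j - of_bool (l = j)) / h)\<bar> \<le> resolvent w i l * C"
      unfolding abs_mult using resolvent_nonneg[OF l] by (simp add: mult_left_mono del: times_divide_eq_right)
  qed simp
  show "((\<lambda>l. resolvent w i l * C) has_sum 1 / w * C) S"
    by (intro has_sum_cmult_left resolvent_has_sum)
qed

end

end

section \<open>The resolvent of the Erlang queue\<close>

definition phase_index :: "nat \<Rightarrow> nat \<times> nat \<Rightarrow> nat" where
  "phase_index k = (\<lambda>(n, s). if n = 0 then 0 else (n - 1) * k + s)"

text \<open>The inverse divides \<open>L - 1\<close> by \<open>k\<close> with remainder; the shift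
  by one is due to phases running from \<open>1\<close> to \<open>k\<close>.\<close>

lemma bij_phase_index:
  assumes "k \<ge> 1"
  shows "bij_betw (phase_index k) (erlang_states k) UNIV"
proof (rule bij_betw_byWitness[where f' = "\<lambda>L. if L = 0 then (0, 0) else ((L - 1) div k + 1, (L - 1) mod k + 1)"])
  show "\<forall>x\<in>erlang_states k. (if phase_index k x = 0 then (0, 0)
      else ((phase_index k x - 1) div k + 1, (phase_index k x - 1) mod k + 1)) = x"
  proof
    fix x assume "x \<in> erlang_states k"
    then consider "x = (0, 0)" | n t where "x = (Suc n, Suc t)" "t < k"
      by (cases x; cases "fst x"; cases "snd x") (auto simp: erlang_states_def)
    then show "(if phase_index k x = 0 then (0, 0)
      else ((phase_index k x - 1) div k + 1, (phase_index k x - 1) mod k + 1)) = x"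
      by cases (auto simp: phase_index_def)
  qed
  show "\<forall>L\<in>UNIV. phase_index k (if L = 0 then (0, 0) else ((L - 1) div k + 1, (L - 1) mod k + 1)) = L"
    by (auto simp: phase_index_def)
qed (use assms in \<open>auto simp: erlang_states_def Suc_le_eq\<close>)

text \<open>An arrival brings \<open>k\<close> phases and each completion removes one, also when it
  lets the next customer start or empties the queue. Thus five kinds of transition become
  two.\<close>

lemma erlang_rate_phase_index:
  assumes k: "k \<ge> 1" and i: "i \<in> erlang_states k" and j: "j \<in> erlang_states k"
  shows "erlang_rate lam mu k i j =
    (if phase_index k j = phase_index k i + k then lam
     else if phase_index k i = Suc (phase_index k j) then real k * mu else 0)"
proof -
  have inj: "phase_index k j = phase_index k x \<longleftrightarrow> j = x" if "x \<in> erlang_states k" for x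
    using bij_betw_imp_inj_on[OF bij_phase_index[OF k]] j that by (auto simp: inj_on_def)
  obtain n s where ns: "i = (n, s)" by (cases i)
  show ?thesis
  proof (cases "n = 0")
    case True
    with i ns have i0: "i = (0, 0)" by (auto simp: erlang_states_def)
    have "(1, k) \<in> erlang_states k" using k by (auto simp: erlang_states_def)
    from inj[OF this] show ?thesis
      by (simp add: i0 erlang_rate_def phase_index_def)
  next
    case False
    then have n: "n \<ge> 1" "1 \<le> s" "s \<le> k" using i ns by (auto simp: erlang_states_def)
    have up: "phase_index k j = phase_index k i + k \<longleftrightarrow> j = (n + 1, s)"
    proof -
      have "(n + 1, s) \<in> erlang_states k" using n by (auto simp: erlang_states_def)
      from inj[OF this] show ?thesis
        using n by (cases n) (simp_all add: ns phase_index_def ac_simps)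
    qed
    define y where "y = (if s \<ge> 2 then (n, s - 1) else if n \<ge> 2 then (n - 1, k) else (0, 0))"
    have "y \<in> erlang_states k" using n k by (auto simp: erlang_states_def y_def)
    note inj[OF this]
    moreover have "phase_index k i = Suc (phase_index k y)"
    proof -
      obtain n' s' where [simp]: "n = Suc n'" "s = Suc s'" using n by (metis Suc_le_D One_nat_def)
      show ?thesis
        by (cases s'; cases n') (auto simp: ns y_def phase_index_def)
    qed
    ultimately have down: "phase_index k i = Suc (phase_index k j) \<longleftrightarrow> j = y" by auto
    show ?thesis
      unfolding up down using n by (auto simp: ns erlang_rate_def y_def)
  qed
qed

lemma generator_erlang:
  fixes e :: "nat \<Rightarrow> nat \<times> nat"
  assumes k: "k \<ge> 1" and e: "bij_betw e UNIV (erlang_states k)" "\<And>L. phase_index k (e L) = L"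
  shows "generator (erlang_states k) (erlang_rate lam mu k) (e L) (e M) =
    (if L = M then - (lam + (if L = 0 then 0 else real k * mu))
     else if M = L + k then lam else if L = Suc M then real k * mu else 0)"
proof -
  have eS: "e L \<in> erlang_states k" for L using e(1) by (auto simp: bij_betw_def)
  have rate: "erlang_rate lam mu k (e L) (e M) =
    (if M = L + k then lam else if L = Suc M then real k * mu else 0)" for M
    using erlang_rate_phase_index[OF k eS eS] e(2) by simp
  have inj: "e L = e M \<longleftrightarrow> L = M" for L M by (metis e(2))
  have bij: "bij_betw e (UNIV - {L}) (erlang_states k - {e L})"
    using e(1) inj by (auto simp: bij_betw_def inj_on_def)
  have "(\<Sum>\<^sub>\<infinity>l\<in>erlang_states k - {e L}. erlang_rate lam mu k (e L) l)
      = (\<Sum>\<^sub>\<infinity>M\<in>UNIV - {L}. erlang_rate lam mu k (e L) (e M))"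
    by (rule infsum_reindex_bij_betw[OF bij, symmetric])
  also have "\<dots> = (\<Sum>M\<in>{L + k} \<union> (if L = 0 then {} else {L - 1}). erlang_rate lam mu k (e L) (e M))"
    unfolding rate using k
    by (subst infsum_finite[symmetric]; (intro infsum_cong_neutral)?) (auto split: if_splits)
  also have "\<dots> = lam + (if L = 0 then 0 else real k * mu)"
    unfolding rate using k by auto
  finally show ?thesis
    by (auto simp: generator_def inj rate)
qed

lemma erlang_bounded_rate_chain:
  assumes "lam > 0" "mu > 0" and k: "k \<ge> 1"
    and "transition_function (erlang_states k) p"
    and "\<And>i j. i \<in> erlang_states k \<Longrightarrow> j \<in> erlang_states k \<Longrightarrow>
      ((\<lambda>h. p h i j) has_real_derivative generator (erlang_states k) (erlang_rate lam mu k) i j) (at_right 0)"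
  shows "bounded_rate_chain (erlang_states k) p (erlang_rate lam mu k) (lam + real k * mu)"
proof
  obtain e where e: "bij_betw e UNIV (erlang_states k)" "\<And>L. phase_index k (e L) = L"
    using bij_phase_index[OF k] bij_betw_inv_into bij_betw_inv_into_right by (metis UNIV_I)
  fix i assume "i \<in> erlang_states k"
  then obtain L where "i = e L" using e(1) by (auto simp: bij_betw_def)
  then show "- generator (erlang_states k) (erlang_rate lam mu k) i i \<le> lam + real k * mu"
    using generator_erlang[OF k e, of lam mu L L] assms(1,2) by auto
qed (use assms in auto)

lemma erlang_transition_continuous:
  assumes "lam > 0" "mu > 0" "k \<ge> 1"
    and "transition_function (erlang_states k) p"
    and "\<And>i j. i \<in> erlang_states k \<Longrightarrow> j \<in> erlang_states k \<Longrightarrow>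
      ((\<lambda>h. p h i j) has_real_derivative generator (erlang_states k) (erlang_rate lam mu k) i j) (at_right 0)"
    and "i \<in> erlang_states k" "j \<in> erlang_states k"
  shows "continuous_on {0..} (\<lambda>t. p t i j)"
  by (rule bounded_rate_chain.p_continuous[OF erlang_bounded_rate_chain[OF assms(1-5)] assms(6,7)])

text \<open>The witness \<open>c\<close> is \<open>real k * mu\<close> times the resolvent at the
  empty state; the series of passage weights makes it explicit.\<close>

theorem erlang_resolvent:
  fixes p :: "real \<Rightarrow> nat \<times> nat \<Rightarrow> nat \<times> nat \<Rightarrow> real"
  assumes lam: "lam > 0" and mu: "mu > 0" and k: "k \<ge> 1" and w: "w > 0"
    and p: "transition_function (erlang_states k) p"
    and deriv: "\<And>i j. i \<in> erlang_states k \<Longrightarrow> j \<in> erlang_states k \<Longrightarrow>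
      ((\<lambda>h. p h i j) has_real_derivative generator (erlang_states k) (erlang_rate lam mu k) i j) (at_right 0)"
    and n: "n \<ge> 1" "1 \<le> s" "s \<le> k"
    and T: "T = lam + real k * mu + w"
  shows "\<exists>c. laplace_transform (\<lambda>t. p t (0, 0) (n, s)) w
      = (1 + c) * walk_green lam (real k * mu) T k (int ((n - 1) * k + s))
        - c * walk_green lam (real k * mu) T k (int ((n - 1) * k + s) + 1)
    \<and> (\<lambda>m. passage lam (real k * mu) T k (Suc m)) sums c"
proof -
  define \<kappa> where "\<kappa> = real k * mu"
  have \<kappa>: "\<kappa> > 0" using k mu by (simp add: \<kappa>_def)
  define e where "e = inv_into (erlang_states k) (phase_index k)"
  have e: "bij_betw e UNIV (erlang_states k)" "phase_index k (e L) = L" for L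
    unfolding e_def using bij_phase_index[OF k]
    by (auto intro: bij_betw_inv_into simp: bij_betw_inv_into_right)
  have eS: "e L \<in> erlang_states k" for L using e(1) by (auto simp: bij_betw_def)
  have e_index: "e (phase_index k x) = x" if "x \<in> erlang_states k" for x
    unfolding e_def by (rule bij_betw_inv_into_left[OF bij_phase_index[OF k] that])
  have zero: "(0, 0) \<in> erlang_states k" and state: "(n, s) \<in> erlang_states k"
    using n by (auto simp: erlang_states_def)
  have e_0: "e 0 = (0, 0)" using e_index[OF zero] by (simp add: phase_index_def)
  interpret chain: bounded_rate_chain "erlang_states k" p "erlang_rate lam mu k" "lam + real k * mu"
    by (rule erlang_bounded_rate_chain[OF lam mu k p deriv])
  interpret walk: discounted_walk lam \<kappa> T k
    by standard (use lam \<kappa> w in \<open>auto simp: T \<kappa>_def\<close>)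
  define R where "R L = chain.resolvent w (0, 0) (e L)" for L
  have R_eq: "w * R M - of_bool (M = 0)
      = (if M \<ge> k then lam * R (M - k) else 0) + \<kappa> * R (Suc M) - (lam + (if M = 0 then 0 else \<kappa>)) * R M" for M
  proof -
    let ?g = "\<lambda>L M. generator (erlang_states k) (erlang_rate lam mu k) (e L) (e M)"
    have "((\<lambda>L. R L * ?g L M) has_sum (w * R M - of_bool ((0, 0) = e M))) UNIV"
      unfolding R_def
      by (rule has_sum_reindex_bij_betw[OF e(1), THEN iffD2, OF chain.resolvent_equation[OF w zero eS]])
    \<comment> \<open>Column \<open>M\<close> of the generator lives on \<open>M\<close> itself, on
      \<open>Suc M\<close> (a completion) and, if it exists, on \<open>M - k\<close> (an
      arrival).\<close>
    moreover have "((\<lambda>L. R L * ?g L M) has_sum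
        (\<Sum>L\<in>{M, Suc M} \<union> (if M \<ge> k then {M - k} else {}). R L * ?g L M)) UNIV"
      by (rule has_sum_finite_neutralI) (auto simp: generator_erlang[OF k e] split: if_splits)
    moreover have "(0, 0) = e M \<longleftrightarrow> M = 0" by (metis e(2) e_0)
    ultimately have "w * R M - of_bool (M = 0)
        = (\<Sum>L\<in>{M, Suc M} \<union> (if M \<ge> k then {M - k} else {}). R L * ?g L M)"
      using has_sum_unique by force
    also have "\<dots> = (if M \<ge> k then lam * R (M - k) else 0) + \<kappa> * R (Suc M)
        - (lam + (if M = 0 then 0 else \<kappa>)) * R M"
    proof (cases "M \<ge> k")
      case True
      then have "{M, Suc M} \<union> (if M \<ge> k then {M - k} else {}) = {M, Suc M, M - k}" by auto
      moreover have "M - k \<noteq> M" "M - k \<noteq> Suc M" using k True by auto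
      ultimately show ?thesis
        using k True by (auto simp: generator_erlang[OF k e] \<kappa>_def algebra_simps)
    next
      case False
      then show ?thesis
        by (auto simp: generator_erlang[OF k e] \<kappa>_def algebra_simps)
    qed
    finally show ?thesis .
  qed
  define P where "P L = (if L < 0 then 0 else R (nat L))" for L :: int
  have bdd: "\<bar>P L\<bar> \<le> 1 / w" for L
    using chain.resolvent_nonneg[OF w zero eS] chain.resolvent_le[OF w zero eS] w
    by (auto simp: P_def R_def)
  have neg: "P L = 0" if "L < 0" for L using that by (simp add: P_def)
  \<comment> \<open>The empty queue has exit rate \<open>lam\<close> only. Adding
    \<open>\<kappa> * P 0\<close> on both sides at \<open>L = 0\<close> gives the same factor
    \<open>T\<close> everywhere, at the price of a larger source.\<close>
  have rec: "T * P L = \<kappa> * P (L + 1) + lam * P (L - int k) + of_bool (L = 0) * (1 + \<kappa> * P 0)"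
    if L: "L \<ge> 0" for L
  proof -
    obtain M where M: "L = int M" using L nonneg_int_cases by blast
    have "P (L + 1) = R (Suc M)" "P (L - int k) = (if M \<ge> k then R (M - k) else 0)" "P L = R M"
      by (auto simp: P_def M nat_add_distrib nat_diff_distrib)
    moreover have "P 0 = R 0" by (simp add: P_def)
    moreover have "T = lam + \<kappa> + w" by (simp add: T \<kappa>_def)
    ultimately show ?thesis
      using R_eq[of M] k by (auto simp: M algebra_simps split: if_splits)
  qed
  have "P (int ((n - 1) * k + s)) = laplace_transform (\<lambda>t. p t (0, 0) (n, s)) w"
  proof -
    have "P (int M) = R M" for M by (simp add: P_def)
    moreover have "(n - 1) * k + s = phase_index k (n, s)" using n by (simp add: phase_index_def)
    ultimately show ?thesis
      using e_index[OF state] by (simp only: R_def chain.resolvent_def)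
  qed
  then show ?thesis
    using walk.reflected_resolvent[OF bdd neg rec]
    unfolding \<kappa>_def[symmetric] by (metis (no_types))
qed

section \<open>The series of the theorem as Green functions and passage weights\<close>

text \<open>With \<open>n + i\<close> jumps up the walk needs \<open>j = k * (i + 1) - s\<close>
  steps down to end at the index of \<open>(n, s)\<close>. The factorials in \<open>B_const\<close>
  form the binomial coefficient of \<open>n + i + j\<close> steps, and \<open>delta_const\<close> is
  that number plus one.\<close>

lemma walk_green_term_B_const:
  assumes n: "n \<ge> 1" "1 \<le> s" "s \<le> k"
  shows "walk_green_term lam (real k * mu) T k (int ((n - 1) * k + s)) (n + i)
    = B_const lam mu k n s i / T ^ delta_const k n s i"
proof -
  obtain n' where n': "n = Suc n'" using n by (cases n) auto
  define j where "j = k * (i + 1) - s"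
  have j: "j + s = k * (i + 1)" using n by (simp add: j_def)
  have eq: "(n + i) * k = (n - 1) * k + s + j"
    using j by (simp add: n' algebra_simps)
  have *: "int ((n - 1) * k + s) \<le> int ((n + i) * k)"
    "nat (int ((n + i) * k) - int ((n - 1) * k + s)) = j"
    unfolding eq by simp_all
  have **: "n + k - s + i * (k + 1) = n + i + j" "n + (i + 1) * (k + 1) - s = n + i + j + 1"
    using j n by (auto simp: algebra_simps)
  show ?thesis
    unfolding walk_green_term_def if_P[OF *(1)] *(2) walk_weight_def B_const_def delta_const_def
      ** j_def[symmetric]
    by (simp add: binomial_fact ac_simps)
qed

text \<open>Fewer than \<open>n\<close> jumps reach at most \<open>(n - 1) * k\<close>, so the Green
  series effectively starts at \<open>r = n\<close>; this is the offset in
  \<open>B_const\<close>.\<close>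

lemma walk_green_term_eq_0:
  assumes "n \<ge> 1" "1 \<le> s" "r < n"
  shows "walk_green_term a b T k (int ((n - 1) * k + s)) r = 0"
proof -
  have "r * k \<le> (n - 1) * k" using assms by (intro mult_right_mono) auto
  then have "\<not> (n - 1) * k + s \<le> r * k" using assms by linarith
  then show ?thesis unfolding walk_green_term_def of_nat_le_iff by (rule if_not_P)
qed

lemma (in discounted_walk) B_const_has_sum:
  assumes n: "n \<ge> 1" "1 \<le> s" "s \<le> k" and b: "b = real k * mu"
  shows "((\<lambda>i. B_const a mu k n s i / T ^ delta_const k n s i) has_sum G (int ((n - 1) * k + s))) UNIV"
    and "0 \<le> B_const a mu k n s i / T ^ delta_const k n s i"
proof -
  let ?L = "int ((n - 1) * k + s)"
  have eq: "g ?L (i + n) = B_const a mu k n s i / T ^ delta_const k n s i" for i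
    using walk_green_term_B_const[OF n, of a mu T i] by (simp add: b add.commute)
  then show "0 \<le> B_const a mu k n s i / T ^ delta_const k n s i"
    using walk_green_term_bound(1)[of ?L "i + n"] by simp
  have "(\<lambda>i. g ?L (i + n)) sums (G ?L - (\<Sum>r<n. g ?L r))"
    unfolding walk_green_def by (intro sums_split_initial_segment summable_sums summable_walk_green_term)
  moreover have "(\<Sum>r<n. g ?L r) = 0"
    using n by (intro sum.neutral ballI walk_green_term_eq_0) auto
  ultimately have "(\<lambda>i. g ?L (i + n)) sums G ?L"
    by (simp only: diff_0_right)
  then show "((\<lambda>i. B_const a mu k n s i / T ^ delta_const k n s i) has_sum G ?L) UNIV"
    unfolding eq[symmetric] by (rule sums_nonneg_imp_has_sum) (rule walk_green_term_bound)
qed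

text \<open>\<open>A0\<close> carries one power of \<open>real k * mu\<close> less than the passage
  weight; the prefactor in \<open>C_const\<close> and \<open>D_const\<close> restores it.\<close>

lemma passage_term_A0:
  assumes "m \<ge> 1"
  shows "passage_term lam (real k * mu) T k m r = real k * mu * A0 lam mu k m r / T ^ a0 k m r"
proof -
  have "(real k * mu) ^ (m + r * k) = real k * mu * (real k * mu) ^ (m + r * k - 1)"
    using assms by (metis One_nat_def Suc_pred add_gr_0 less_le_trans power_Suc zero_less_one)
  then show ?thesis
    using assms unfolding passage_term_def A0_def a0_def by (simp add: ac_simps)
qed

lemma (in discounted_walk) passage_has_sum: "(f m has_sum F m) UNIV"
  unfolding passage_def
  by (rule sums_nonneg_imp_has_sum[OF summable_sums[OF summable_passage_term]]) (rule passage_term_bound)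

lemma (in discounted_walk) passage_has_sum_atLeast_1:
  assumes "(\<lambda>m. F (Suc m)) sums c"
  shows "(F has_sum c) {1..}"
proof -
  have "bij_betw Suc UNIV {1..}"
    by (auto simp: bij_betw_def image_iff Suc_le_eq gr0_conv_Suc)
  then show ?thesis
    using sums_nonneg_imp_has_sum[OF assms] passage_bound has_sum_reindex_bij_betw by blast
qed

text \<open>The triple series have terms of product form, a \<open>B\<close>-term times a passage
  weight. Nonnegativity turns the iterated sums into summability over triples.\<close>

lemma product_iterated_infsum:
  fixes x :: "'a \<Rightarrow> real" and y :: "'b \<Rightarrow> 'c \<Rightarrow> real"
  assumes x: "(x has_sum X) A" "\<And>i. i \<in> A \<Longrightarrow> 0 \<le> x i"
    and y: "\<And>m. m \<in> I \<Longrightarrow> (y m has_sum Y m) J" "\<And>m r. m \<in> I \<Longrightarrow> r \<in> J \<Longrightarrow> 0 \<le> y m r"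
    and Y: "(Y has_sum c) I"
  shows "(\<lambda>(i, m, r). x i * y m r) summable_on A \<times> I \<times> J"
    and "(\<Sum>\<^sub>\<infinity>i\<in>A. \<Sum>\<^sub>\<infinity>m\<in>I. \<Sum>\<^sub>\<infinity>r\<in>J. x i * y m r) = X * c"
proof -
  have inner: "((\<lambda>r. x i * y m r) has_sum x i * Y m) J" if "m \<in> I" for i m
    by (intro has_sum_cmult_right y that)
  have mid: "((\<lambda>m. x i * Y m) has_sum x i * c) I" for i
    by (intro has_sum_cmult_right Y)
  have outer: "((\<lambda>i. x i * c) has_sum X * c) A"
    by (intro has_sum_cmult_left x)
  have "((\<lambda>(m, r). x i * y m r) has_sum x i * c) (I \<times> J)" if "i \<in> A" for i
    by (rule has_sum_SigmaI[OF _ mid])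
       (use inner x(2)[OF that] y(2) in \<open>auto intro!: summable_on_SigmaI has_sum_imp_summable[OF mid]\<close>)
  then show "(\<lambda>(i, m, r). x i * y m r) summable_on A \<times> I \<times> J"
    using outer x(2) y(2)
    by (intro summable_on_SigmaI[where g = "\<lambda>i. x i * c"]) (auto simp: has_sum_iff)
  have "(\<Sum>\<^sub>\<infinity>i\<in>A. \<Sum>\<^sub>\<infinity>m\<in>I. \<Sum>\<^sub>\<infinity>r\<in>J. x i * y m r) = (\<Sum>\<^sub>\<infinity>i\<in>A. \<Sum>\<^sub>\<infinity>m\<in>I. x i * Y m)"
    by (intro infsum_cong infsumI inner)
  also have "\<dots> = (\<Sum>\<^sub>\<infinity>i\<in>A. x i * c)"
    by (intro infsum_cong infsumI mid)
  also have "\<dots> = X * c"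
    by (intro infsumI outer)
  finally show "(\<Sum>\<^sub>\<infinity>i\<in>A. \<Sum>\<^sub>\<infinity>m\<in>I. \<Sum>\<^sub>\<infinity>r\<in>J. x i * y m r) = X * c" .
qed

section \<open>The inverse subordinator and the time change\<close>

lemma inverse_subordinator_nonneg: "0 \<le> inverse_subordinator D t \<omega>"
  by (auto simp: inverse_subordinator_def intro!: cInf_greatest)

text \<open>By monotonicity a passage before \<open>a\<close> still holds at a later rational before
  \<open>a\<close>. A countable quantifier results, hence measurability jointly in time and outcome;
  \<open>max 0\<close> keeps the index in the time range.\<close>

lemma rational_passage_iff:
  fixes d :: "real \<Rightarrow> real"
  assumes "mono_on {0..} d"
  shows "(\<exists>s\<ge>0. s < a \<and> t < d s) \<longleftrightarrow> (\<exists>r::rat. max 0 (of_rat r) < a \<and> t < d (max 0 (of_rat r)))"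
proof
  assume "\<exists>s\<ge>0. s < a \<and> t < d s"
  then obtain s where s: "s \<ge> 0" "s < a" "t < d s" by blast
  from of_rat_dense[OF s(2)] obtain r :: rat where r: "s < of_rat r" "of_rat r < a" by blast
  have "d s \<le> d (max 0 (of_rat r))"
    using s r by (intro mono_onD[OF assms]) auto
  then show "\<exists>r::rat. max 0 (of_rat r) < a \<and> t < d (max 0 (of_rat r))"
    using s r by (intro exI[of _ r]) auto
qed (auto intro: exI[of _ "max 0 _"])

lemma inverse_subordinator_less_iff:
  assumes "mono_on {0..} (\<lambda>s. D s \<omega>)"
  shows "inverse_subordinator D t \<omega> < a \<longleftrightarrow>
    (if t = 0 \<or> (\<forall>r::rat. D (max 0 (of_rat r)) \<omega> \<le> t) then 0 < a
     else \<exists>r::rat. max 0 (of_rat r) < a \<and> t < D (max 0 (of_rat r)) \<omega>)"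
proof -
  let ?E = "{s. 0 \<le> s \<and> t < D s \<omega>}"
  have "?E = {} \<longleftrightarrow> (\<forall>r::rat. D (max 0 (of_rat r)) \<omega> \<le> t)"
  proof
    assume *: "\<forall>r::rat. D (max 0 (of_rat r)) \<omega> \<le> t"
    show "?E = {}"
    proof (rule ccontr)
      assume "?E \<noteq> {}"
      then obtain s where "s \<ge> 0" "s < s + 1" "t < D s \<omega>" by auto
      then show False
        using rational_passage_iff[OF assms, of "s + 1" t] * by (meson linorder_not_le)
    qed
  next
    assume "?E = {}"
    then have "\<not> t < D (max 0 (of_rat r)) \<omega>" for r
      by (metis (mono_tags, lifting) empty_Collect_eq max.cobounded1)
    then show "\<forall>r::rat. D (max 0 (of_rat r)) \<omega> \<le> t" by (simp add: not_less)
  qed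
  moreover have "Inf ?E < a \<longleftrightarrow> (\<exists>s\<ge>0. s < a \<and> t < D s \<omega>)" if "?E \<noteq> {}"
    by (subst cInf_less_iff[OF that bdd_belowI[of _ 0]]) auto
  ultimately show ?thesis
    unfolding inverse_subordinator_def rational_passage_iff[OF assms] by auto
qed

lemma measurable_inverse_subordinator:
  assumes D: "\<And>s. s \<ge> 0 \<Longrightarrow> D s \<in> borel_measurable M"
    and mono: "\<And>\<omega>. \<omega> \<in> space M \<Longrightarrow> mono_on {0..} (\<lambda>s. D s \<omega>)"
  shows "(\<lambda>(t, \<omega>). inverse_subordinator D t \<omega>) \<in> borel_measurable (borel \<Otimes>\<^sub>M M)"
proof (rule borel_measurableI_less)
  fix a :: real
  define D' where "D' r = D (max 0 (of_rat r))" for r :: rat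
  have [measurable]: "D' r \<in> borel_measurable M" for r
    unfolding D'_def by (rule D) simp
  have "{x \<in> space (borel \<Otimes>\<^sub>M M). (case x of (t, \<omega>) \<Rightarrow> inverse_subordinator D t \<omega>) < a} =
    {x \<in> space (borel \<Otimes>\<^sub>M M). if fst x = 0 \<or> (\<forall>r. D' r (snd x) \<le> fst x) then 0 < a
      else \<exists>r. max 0 (of_rat r) < a \<and> fst x < D' r (snd x)}"
    unfolding D'_def
    by (intro Collect_cong conj_cong refl) (auto simp only: split_beta space_pair_measure mem_Times_iff
        inverse_subordinator_less_iff[OF mono])
  also have "\<dots> \<in> sets (borel \<Otimes>\<^sub>M M)" by measurable
  finally show "{x \<in> space (borel \<Otimes>\<^sub>M M). (case x of (t, \<omega>) \<Rightarrow> inverse_subordinator D t \<omega>) < a} \<in> sets (borel \<Otimes>\<^sub>M M)" .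
qed

text \<open>If \<open>D y < t\<close>, right-continuity keeps the path below \<open>t\<close> a
  little beyond \<open>y\<close>. The case \<open>t = D y\<close> is excluded: a path that is flat
  to the right of \<open>y\<close> passes \<open>t\<close> only later.\<close>

lemma inverse_subordinator_le_iff:
  assumes mono: "mono_on {0..} (\<lambda>s. D s \<omega>)"
    and right: "((\<lambda>s. D s \<omega>) \<longlongrightarrow> D y \<omega>) (at_right y)"
    and y: "y \<ge> 0" and t: "t \<noteq> 0" "t \<noteq> D y \<omega>" and ne: "\<exists>s\<ge>0. t < D s \<omega>"
  shows "inverse_subordinator D t \<omega> \<le> y \<longleftrightarrow> t \<le> D y \<omega>"
proof -
  let ?E = "{s. 0 \<le> s \<and> t < D s \<omega>}"
  have Y: "inverse_subordinator D t \<omega> = Inf ?E"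
    using t ne by (auto simp: inverse_subordinator_def)
  show ?thesis
  proof (cases "t \<le> D y \<omega>")
    case True
    then have "y \<in> ?E" using y t by auto
    then have "Inf ?E \<le> y" by (intro cInf_lower bdd_belowI[of _ 0]) auto
    then show ?thesis using True Y by simp
  next
    case False
    then have "eventually (\<lambda>s. D s \<omega> < t) (at_right y)"
      by (intro order_tendstoD[OF right]) simp
    then obtain b where b: "b > y" "\<And>s. y < s \<Longrightarrow> s < b \<Longrightarrow> D s \<omega> < t"
      unfolding eventually_at_right_field by blast
    define c where "c = (y + b) / 2"
    have c: "y < c" "c < b" using b(1) by (auto simp: c_def)
    have "c \<le> s" if "s \<in> ?E" for s
    proof (rule ccontr)
      assume "\<not> c \<le> s"
      then have "D s \<omega> \<le> D c \<omega>" using that c y by (intro mono_onD[OF mono]) auto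
      then show False using b(2)[OF c] that by simp
    qed
    then have "c \<le> Inf ?E" using ne by (intro cInf_greatest) auto
    then show ?thesis using False Y c by simp
  qed
qed

context
  fixes M :: "'w measure" and D :: "real \<Rightarrow> 'w \<Rightarrow> real" and \<phi> z :: real
  assumes M: "prob_space M"
    and D_meas: "\<And>s. s \<ge> 0 \<Longrightarrow> D s \<in> borel_measurable M"
    and D_0: "AE \<omega> in M. D 0 \<omega> = 0"
    and D_mono: "\<And>\<omega>. \<omega> \<in> space M \<Longrightarrow> mono_on {0..} (\<lambda>s. D s \<omega>)"
    and D_right: "\<And>\<omega> s. \<omega> \<in> space M \<Longrightarrow> s \<ge> 0 \<Longrightarrow> ((\<lambda>u. D u \<omega>) \<longlongrightarrow> D s \<omega>) (at_right s)"
    and z: "z > 0" and \<phi>: "\<phi> > 0"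
    and D_laplace: "\<And>s. s \<ge> 0 \<Longrightarrow> prob_space.expectation M (\<lambda>\<omega>. exp (- z * D s \<omega>)) = exp (- s * \<phi>)"
begin

interpretation M: prob_space M by (fact M)

text \<open>A non-integrable function has integral \<open>0\<close> by convention, whereas the given
  expectation is an exponential.\<close>

lemma integrable_exp_subordinator: "s \<ge> 0 \<Longrightarrow> integrable M (\<lambda>\<omega>. exp (- z * D s \<omega>))"
  using D_laplace[of s] not_integrable_integral_eq[of M "\<lambda>\<omega>. exp (- z * D s \<omega>)"]
  by (metis exp_not_eq_zero)

lemma subordinator_nonneg:
  assumes "s \<ge> 0"
  shows "AE \<omega> in M. 0 \<le> D s \<omega>"
  using D_0 AE_space
proof eventually_elim
  case (elim \<omega>)
  then show ?case using mono_onD[OF D_mono[OF elim(2)], of 0 s] assms by simp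
qed

text \<open>On the event \<open>B\<close> that the path never exceeds \<open>t\<close>,
  \<open>exp (- z * D m)\<close> is at least \<open>exp (- z * t)\<close>, while its expectation
  \<open>exp (- \<phi>) ^ m\<close> tends to \<open>0\<close>. So the default value of the inverse
  is almost surely not taken.\<close>

lemma subordinator_unbounded: "AE \<omega> in M. \<exists>r::rat. t < D (max 0 (of_rat r)) \<omega>"
proof -
  define D' where "D' r = D (max 0 (of_rat r))" for r :: rat
  have [measurable]: "D' r \<in> borel_measurable M" for r
    unfolding D'_def by (rule D_meas) simp
  define B where "B = {\<omega> \<in> space M. \<forall>r. D' r \<omega> \<le> t}"
  have [measurable]: "B \<in> sets M" unfolding B_def by measurable
  have le: "M.prob B * exp (- z * t) \<le> exp (- \<phi>) ^ m" for m
  proof -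
    have "M.prob B * exp (- z * t) = (\<integral>\<omega>. indicator B \<omega> * exp (- z * t) \<partial>M)"
      by simp
    also have "\<dots> \<le> (\<integral>\<omega>. exp (- z * D (real m) \<omega>) \<partial>M)"
    proof (rule integral_mono)
      fix \<omega>
      have "D (real m) \<omega> \<le> t" if "\<omega> \<in> B"
        using that unfolding B_def D'_def by (auto dest: spec[of _ "of_nat m"])
      then show "indicator B \<omega> * exp (- z * t) \<le> exp (- z * D (real m) \<omega>)"
        using z by (auto simp: indicator_def)
      show "integrable M (\<lambda>\<omega>. indicator B \<omega> * exp (- z * t))"
        by (intro integrable_mult_left integrable_real_indicator) (auto simp: M.emeasure_eq_measure)
    qed (rule integrable_exp_subordinator, simp)
    also have "\<dots> = exp (- \<phi>) ^ m"
      using D_laplace[of "real m"] by (simp add: exp_of_nat_mult[symmetric])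
    finally show ?thesis .
  qed
  have "(\<lambda>m. exp (- \<phi>) ^ m) \<longlonglongrightarrow> 0"
    using \<phi> by (intro LIMSEQ_power_zero) simp
  then have "M.prob B * exp (- z * t) \<le> 0"
    by (rule LIMSEQ_le_const) (use le in auto)
  then have "M.prob B = 0"
    by (smt (verit) exp_gt_zero measure_nonneg mult_pos_pos)
  then have "AE \<omega> in M. \<omega> \<notin> B"
    by (intro AE_not_in) (simp add: null_sets_def M.emeasure_eq_measure)
  then show ?thesis
    using AE_space by eventually_elim (auto simp: B_def D'_def not_le)
qed

text \<open>The events \<open>inverse_subordinator D t \<le> y\<close> and \<open>t \<le> D y\<close> only differ where \<open>t = D y\<close>, which is
  a null set of pairs of a time and an outcome.\<close>

lemma inverse_subordinator_exponential:
  "distributed (density lborel (exponential_density z) \<Otimes>\<^sub>M M) lborel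
     (\<lambda>(t, \<omega>). inverse_subordinator D t \<omega>) (exponential_density \<phi>)"
proof (rule exponential_distributedI)
  define E where "E = density lborel (exponential_density z)"
  interpret E: prob_space E
    unfolding E_def by (rule prob_space_exponential_density[OF z])
  interpret pair_prob_space E M ..
  have sets_E[measurable_cong]: "sets E = sets borel" by (simp add: E_def)
  have meas: "(\<lambda>(t, \<omega>). inverse_subordinator D t \<omega>) \<in> borel_measurable (E \<Otimes>\<^sub>M M)"
    using measurable_inverse_subordinator[OF D_meas D_mono]
    by (subst measurable_cong_sets[OF sets_pair_measure_cong[OF sets_E refl] refl])
  then show "(\<lambda>(t, \<omega>). inverse_subordinator D t \<omega>)
      \<in> borel_measurable (density lborel (exponential_density z) \<Otimes>\<^sub>M M)"
    by (simp add: E_def)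
  show "\<phi> > 0" by (fact \<phi>)
  fix y :: real assume y: "y \<ge> 0"
  have [measurable]: "D y \<in> borel_measurable M" by (rule D_meas[OF y])
  define D' where "D' r = D (max 0 (of_rat r))" for r :: rat
  have [measurable]: "D' r \<in> borel_measurable M" for r
    unfolding D'_def by (rule D_meas) simp
  have E_AE: "AE t in E. P t" if "AE t in lborel. t \<ge> 0 \<longrightarrow> P t" for P
    unfolding E_def using that by (subst AE_density) (auto simp: exponential_density_def)
  have E_neq: "AE t in E. t \<noteq> c" for c
    using AE_lborel_singleton[of c] by (intro E_AE) (auto elim: eventually_mono)
  \<comment> \<open>For a fixed outcome the bad set is one point in time, null for the exponential
    law; Fubini then exchanges the quantifiers.\<close>
  have "AE \<omega> in M. AE t in E. t \<noteq> D y \<omega>"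
    by (intro AE_I2 E_neq)
  then have "AE t in E. AE \<omega> in M. t \<noteq> D y \<omega>"
    by (subst AE_commute) auto
  then have 1: "AE x in E \<Otimes>\<^sub>M M. fst x \<noteq> D y (snd x)"
    by (intro AE_pair_measure) auto
  have 2: "AE x in E \<Otimes>\<^sub>M M. fst x \<noteq> 0"
    by (intro AE_pair_measure) (simp_all add: E_neq)
  have 3: "AE x in E \<Otimes>\<^sub>M M. \<exists>r. fst x < D' r (snd x)"
    by (intro AE_pair_measure) (use subordinator_unbounded in \<open>auto simp: D'_def[symmetric]\<close>)
  have AE: "AE x in E \<Otimes>\<^sub>M M. (case x of (t, \<omega>) \<Rightarrow> inverse_subordinator D t \<omega>) \<le> y \<longleftrightarrow> fst x \<le> D y (snd x)"
    using 1 2 3 AE_space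
  proof eventually_elim
    case (elim x)
    then have "snd x \<in> space M" by (auto simp: space_pair_measure)
    moreover have "\<exists>s\<ge>0. fst x < D s (snd x)"
      using elim(3) unfolding D'_def by (meson max.cobounded1)
    ultimately show ?case
      unfolding split_beta
      by (intro inverse_subordinator_le_iff D_mono D_right y elim(1,2))
  qed
  have "emeasure (E \<Otimes>\<^sub>M M) {x \<in> space (E \<Otimes>\<^sub>M M). (case x of (t, \<omega>) \<Rightarrow> inverse_subordinator D t \<omega>) \<le> y}
      = emeasure (E \<Otimes>\<^sub>M M) {x \<in> space (E \<Otimes>\<^sub>M M). fst x \<le> D y (snd x)}"
    using AE meas by (intro emeasure_eq_AE) auto
  also have "\<dots> = (\<integral>\<^sup>+\<omega>. emeasure E ((\<lambda>t. (t, \<omega>)) -` {x \<in> space (E \<Otimes>\<^sub>M M). fst x \<le> D y (snd x)}) \<partial>M)"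
    by (rule emeasure_pair_measure_alt2) measurable
  \<comment> \<open>With the outcome frozen, the exponential time is at most \<open>D y\<close> with
    probability \<open>1 - exp (- z * D y)\<close>; the expectation of this is known from the
    Laplace exponent.\<close>
  also have "\<dots> = (\<integral>\<^sup>+\<omega>. ennreal (1 - exp (- z * D y \<omega>)) \<partial>M)"
  proof (rule nn_integral_cong_AE)
    have "distributed E lborel (\<lambda>t. t) (exponential_density z)"
      unfolding distributed_def E_def by (simp add: distr_id2)
    note le = E.exponential_distributedD_le[OF this _ z]
    show "AE \<omega> in M. emeasure E ((\<lambda>t. (t, \<omega>)) -` {x \<in> space (E \<Otimes>\<^sub>M M). fst x \<le> D y (snd x)})
        = ennreal (1 - exp (- z * D y \<omega>))"
      using subordinator_nonneg[OF y] AE_space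
    proof eventually_elim
      case (elim \<omega>)
      have "(\<lambda>t. (t, \<omega>)) -` {x \<in> space (E \<Otimes>\<^sub>M M). fst x \<le> D y (snd x)} = {t \<in> space E. t \<le> D y \<omega>}"
        using elim by (auto simp: space_pair_measure)
      then show ?case
        using le[OF elim(1)] by (simp add: E.emeasure_eq_measure mult.commute)
    qed
  qed
  also have "\<dots> = ennreal (\<integral>\<omega>. 1 - exp (- z * D y \<omega>) \<partial>M)"
  proof (rule nn_integral_eq_integral)
    show "integrable M (\<lambda>\<omega>. 1 - exp (- z * D y \<omega>))"
      using integrable_exp_subordinator[OF y] by simp
    show "AE \<omega> in M. 0 \<le> 1 - exp (- z * D y \<omega>)"
      using subordinator_nonneg[OF y] by eventually_elim (use z in simp)
  qed
  also have "(\<integral>\<omega>. 1 - exp (- z * D y \<omega>) \<partial>M) = 1 - exp (- y * \<phi>)"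
    using integrable_exp_subordinator[OF y] D_laplace[OF y] by (simp add: M.prob_space)
  finally show "emeasure (density lborel (exponential_density z) \<Otimes>\<^sub>M M)
      {x \<in> space (density lborel (exponential_density z) \<Otimes>\<^sub>M M).
        (case x of (t, \<omega>) \<Rightarrow> inverse_subordinator D t \<omega>) \<le> y} = 1 - ennreal (exp (- y * \<phi>))"
    unfolding E_def by (simp add: ennreal_minus flip: ennreal_1)
qed

lemma laplace_transform_inverse_subordinator:
  fixes q :: "real \<Rightarrow> real"
  assumes q: "continuous_on {0..} q" "\<And>y. y \<ge> 0 \<Longrightarrow> \<bar>q y\<bar> \<le> 1"
  shows "set_integrable lborel {0..} (\<lambda>t. exp (- z * t) * (\<integral>\<omega>. q (inverse_subordinator D t \<omega>) \<partial>M))"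
    and "laplace_transform (\<lambda>t. \<integral>\<omega>. q (inverse_subordinator D t \<omega>) \<partial>M) z
      = \<phi> / z * laplace_transform q \<phi>"
proof -
  let ?Y = "inverse_subordinator D"
  \<comment> \<open>\<open>q\<close> is controlled on the half line only; extension by zero makes it
    Borel and changes nothing on the nonnegative inverse.\<close>
  define q' where "q' y = indicator {0..} y * q y" for y :: real
  have q'_meas[measurable]: "q' \<in> borel_measurable borel"
    using borel_measurable_continuous_on_indicator[OF _ q(1)] by (simp add: q'_def[abs_def])
  have q'_le: "\<bar>q' y\<bar> \<le> 1" for y
    using q(2)[of y] by (auto simp: q'_def indicator_def)
  have q'_eq: "q (?Y t \<omega>) = q' (?Y t \<omega>)" for t \<omega>
    using inverse_subordinator_nonneg[of D t \<omega>] by (simp add: q'_def)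
  define E where "E = density lborel (exponential_density z)"
  interpret E: prob_space E
    unfolding E_def by (rule prob_space_exponential_density[OF z])
  interpret pair_prob_space E M ..
  have sets_E[measurable_cong]: "sets E = sets borel" by (simp add: E_def)
  note Y_meas[measurable] = measurable_inverse_subordinator[OF D_meas D_mono]
  define P where "P t = (\<integral>\<omega>. q' (?Y t \<omega>) \<partial>M)" for t
  have "(\<lambda>(t, \<omega>). q' (?Y t \<omega>)) \<in> borel_measurable (borel \<Otimes>\<^sub>M M)"
    using measurable_compose[OF Y_meas q'_meas] by (simp add: split_beta)
  note joint = this
  have P_meas[measurable]: "P \<in> borel_measurable borel"
    unfolding P_def[abs_def] using M.borel_measurable_lebesgue_integral[OF joint] .
  have Y_sect: "?Y t \<in> borel_measurable M" for t
    using measurable_compose[OF measurable_Pair1' Y_meas, of t] by simp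
  have P_le: "\<bar>P t\<bar> \<le> 1" for t
  proof -
    have "\<bar>P t\<bar> \<le> (\<integral>\<omega>. 1 \<partial>M)"
      unfolding P_def
      by (rule order_trans[OF integral_abs_bound integral_mono])
         (use q'_le measurable_compose[OF Y_sect q'_meas] in \<open>auto intro!: M.integrable_const_bound[where B = 1]\<close>)
    then show ?thesis by (simp add: M.prob_space)
  qed
  show "set_integrable lborel {0..} (\<lambda>t. exp (- z * t) * (\<integral>\<omega>. q (?Y t \<omega>) \<partial>M))"
    unfolding q'_eq P_def[symmetric]
    by (rule set_integrable_exp_mult[OF z _ P_le]) (simp add: set_borel_measurable_def)
  \<comment> \<open>The factor \<open>1 / z\<close> normalises the Laplace kernel to the density of
    an exponential time.\<close>
  have "laplace_transform P z = (\<integral>t. 1 / z * (exponential_density z t *\<^sub>R P t) \<partial>lborel)"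
    unfolding laplace_transform_def set_lebesgue_integral_def
    using z by (intro Bochner_Integration.integral_cong refl)
      (auto simp: exponential_density_def indicator_def mult.commute)
  also have "\<dots> = 1 / z * (\<integral>t. exponential_density z t *\<^sub>R P t \<partial>lborel)"
    by (rule integral_mult_right_zero)
  also have "(\<integral>t. exponential_density z t *\<^sub>R P t \<partial>lborel) = (\<integral>t. P t \<partial>E)"
    unfolding E_def using z by (intro integral_density[symmetric]) (auto simp: exponential_density_nonneg)
  also have "\<dots> = (\<integral>x. q' (case x of (t, \<omega>) \<Rightarrow> ?Y t \<omega>) \<partial>(E \<Otimes>\<^sub>M M))"
    unfolding P_def
    by (subst integral_fst'[symmetric])
       (use q'_le in \<open>auto intro!: integrable_const_bound[where B = 1]\<close>)
  also have "\<dots> = (\<integral>y. exponential_density \<phi> y * q' y \<partial>lborel)"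
    using inverse_subordinator_exponential unfolding E_def[symmetric]
    by (intro distributed_integral[symmetric]) (auto simp: exponential_density_nonneg \<phi>)
  also have "\<dots> = (\<integral>y. \<phi> * (indicator {0..} y *\<^sub>R (exp (- \<phi> * y) * q y)) \<partial>lborel)"
    by (intro Bochner_Integration.integral_cong refl)
       (auto simp: exponential_density_def q'_def indicator_def mult.commute)
  also have "\<dots> = \<phi> * laplace_transform q \<phi>"
    unfolding laplace_transform_def set_lebesgue_integral_def by (rule integral_mult_right_zero)
  finally show "laplace_transform (\<lambda>t. \<integral>\<omega>. q (?Y t \<omega>) \<partial>M) z = \<phi> / z * laplace_transform q \<phi>"
    unfolding q'_eq P_def[symmetric] by simp
qed

end

section \<open>Independent time change of a right-continuous jump process\<close>

text \<open>Adding one to the floor puts the grid points strictly to the right of \<open>y\<close>,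
  where the values of a right-continuous jump path eventually agree with its value at
  \<open>y\<close>.\<close>

lemma right_grid_approximation:
  fixes y :: real
  assumes "y \<ge> 0"
  shows "filterlim (\<lambda>n. (real (nat \<lfloor>real (Suc n) * y\<rfloor>) + 1) / real (Suc n)) (at_right y) sequentially"
proof (rule tendsto_imp_filterlim_at_right)
  let ?r = "\<lambda>n. (real (nat \<lfloor>real (Suc n) * y\<rfloor>) + 1) / real (Suc n)"
  have r: "y < ?r n" "?r n \<le> y + 1 / real (Suc n)" for n
  proof -
    have *: "real (nat \<lfloor>real (Suc n) * y\<rfloor>) = of_int \<lfloor>real (Suc n) * y\<rfloor>"
      using assms by simp
    show "y < ?r n" unfolding *
      by (subst less_divide_eq) (use floor_correct[of "real (Suc n) * y"] in \<open>auto simp: mult.commute simp del: of_nat_Suc\<close>)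
    have "?r n \<le> (real (Suc n) * y + 1) / real (Suc n)"
      unfolding * by (intro divide_right_mono add_right_mono of_int_floor_le) simp
    then show "?r n \<le> y + 1 / real (Suc n)" by (simp add: add_divide_distrib del: of_nat_Suc)
  qed
  then show "eventually (\<lambda>n. y < ?r n) sequentially" by simp
  have "(\<lambda>n. y + inverse (real (Suc n))) \<longlonglongrightarrow> y + 0"
    by (intro tendsto_add tendsto_const LIMSEQ_inverse_real_of_nat)
  then have lim: "(\<lambda>n. y + 1 / real (Suc n)) \<longlonglongrightarrow> y"
    by (simp only: inverse_eq_divide add_0_right)
  show "?r \<longlonglongrightarrow> y"
    by (rule tendsto_sandwich[OF always_eventually always_eventually tendsto_const lim])
       (intro allI less_imp_le r)+
qed

text \<open>By independence the law of the path together with the random time is a product, so by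
  Fubini the time may be frozen at \<open>y\<close>, which gives \<open>q y\<close>. This needs the
  event \<open>X y = x\<close> to be measurable jointly in outcome and time.\<close>

lemma prob_time_change:
  fixes X :: "real \<Rightarrow> 'w \<Rightarrow> 's" and Y :: "real \<Rightarrow> 'w \<Rightarrow> real"
  assumes M: "prob_space M"
    and X: "\<And>t. t \<ge> 0 \<Longrightarrow> X t \<in> measurable M (count_space S)"
    and right: "\<And>\<omega> t. \<omega> \<in> space M \<Longrightarrow> t \<ge> 0 \<Longrightarrow> eventually (\<lambda>u. X u \<omega> = X t \<omega>) (at_right t)"
    and Y: "Y t \<in> borel_measurable M" "\<And>\<omega>. 0 \<le> Y t \<omega>"
    and indep: "indep_processes M (count_space S) X borel Y"
    and x: "x \<in> S" and t: "t \<ge> 0"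
    and q: "\<And>y. y \<ge> 0 \<Longrightarrow> q y = measure M {\<omega> \<in> space M. X y \<omega> = x}" "continuous_on {0..} q"
  shows "{\<omega> \<in> space M. X (Y t \<omega>) \<omega> = x} \<in> sets M"
    and "measure M {\<omega> \<in> space M. X (Y t \<omega>) \<omega> = x} = (\<integral>\<omega>. q (Y t \<omega>) \<partial>M)"
proof -
  interpret M: prob_space M by (fact M)
  \<comment> \<open>The outcome itself, seen only through the events of \<open>X\<close>, serves as
    the random element that represents the whole path.\<close>
  define F where "F = sigma (space M) {X t -` A \<inter> space M | t A. 0 \<le> t \<and> A \<in> sets (count_space S)}"
  have space_F: "space F = space M" unfolding F_def by (rule space_measure_of_conv)
  have sets_F: "sets F = process_events M (count_space S) X"
    unfolding F_def process_events_def by (rule sets_measure_of) auto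
  have F_le: "sets F \<subseteq> sets M"
    unfolding sets_F process_events_def using X
    by (intro sets.sigma_sets_subset) (auto intro!: measurable_sets[OF X])
  have X_F[measurable]: "X s \<in> measurable F (count_space S)" if "s \<ge> 0" for s
  proof (rule measurableI)
    fix A assume A: "A \<in> sets (count_space S)"
    show "X s -` A \<inter> space F \<in> sets F"
      unfolding sets_F space_F process_events_def using that A by (intro sigma_sets.Basic) blast
  qed (use measurable_space[OF X[OF that]] in \<open>simp add: space_F\<close>)
  define r where "r n j = (real j + 1) / real (Suc n)" for n j
  have X_pred[measurable]: "Measurable.pred F (\<lambda>\<omega>. X (r n j) \<omega> = x)" for n j
  proof -
    have "X (r n j) \<in> measurable F (count_space S)" by (rule X_F) (simp add: r_def)
    from measurable_sets[OF this, of "{x}"] show ?thesis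
      using x by (simp add: pred_def vimage_def Int_def conj_commute)
  qed
  \<comment> \<open>Joint measurability of \<open>X y = x\<close> is obtained along the grid. Naming
    the integer part \<open>j\<close> splits the condition into countably many, each with
    \<open>X\<close> at a fixed time.\<close>
  define H where "H = {p \<in> space (F \<Otimes>\<^sub>M borel). \<exists>N. \<forall>n\<ge>N. \<exists>j::nat.
    nat \<lfloor>real (Suc n) * snd p\<rfloor> = j \<and> X (r n j) (fst p) = x}"
  have H_meas: "H \<in> sets (F \<Otimes>\<^sub>M borel)"
    unfolding H_def by measurable
  have H_iff: "(\<omega>, y) \<in> H \<longleftrightarrow> X y \<omega> = x" if "\<omega> \<in> space M" "y \<ge> 0" for \<omega> y
  proof -
    have "eventually (\<lambda>n. X ((real (nat \<lfloor>real (Suc n) * y\<rfloor>) + 1) / real (Suc n)) \<omega> = X y \<omega>) sequentially"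
      using right[OF that] right_grid_approximation[OF that(2)] by (rule eventually_compose_filterlim)
    then obtain N0 where N0: "\<And>n. n \<ge> N0 \<Longrightarrow> X (r n (nat \<lfloor>real (Suc n) * y\<rfloor>)) \<omega> = X y \<omega>"
      unfolding eventually_sequentially r_def by blast
    have "(\<omega>, y) \<in> H \<longleftrightarrow> (\<exists>N. \<forall>n\<ge>N. X (r n (nat \<lfloor>real (Suc n) * y\<rfloor>)) \<omega> = x)"
      using that by (simp add: H_def space_pair_measure space_F)
    also have "\<dots> \<longleftrightarrow> X y \<omega> = x"
      using N0 by (metis max.cobounded1 max.cobounded2)
    finally show ?thesis .
  qed
  have id: "(\<lambda>\<omega>. \<omega>) \<in> measurable M F"
    by (rule measurableI) (use F_le space_F sets.sets_into_space in \<open>auto simp: Int_absorb2\<close>)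
  interpret MF: prob_space "distr M F (\<lambda>\<omega>. \<omega>)" by (rule M.prob_space_distr[OF id])
  interpret MY: prob_space "distr M borel (Y t)" by (rule M.prob_space_distr[OF Y(1)])
  interpret pair_prob_space "distr M F (\<lambda>\<omega>. \<omega>)" "distr M borel (Y t)" ..
  have pair: "(\<lambda>\<omega>. (\<omega>, Y t \<omega>)) \<in> measurable M (F \<Otimes>\<^sub>M borel)"
    using id Y(1) by (rule measurable_Pair)
  have distr: "distr M F (\<lambda>\<omega>. \<omega>) \<Otimes>\<^sub>M distr M borel (Y t) = distr M (F \<Otimes>\<^sub>M borel) (\<lambda>\<omega>. (\<omega>, Y t \<omega>))"
  proof (rule pair_measure_eqI)
    fix A B assume "A \<in> sets (distr M F (\<lambda>\<omega>. \<omega>))" "B \<in> sets (distr M borel (Y t))"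
    then have A: "A \<in> sets F" and B: "B \<in> sets borel" by simp_all
    have AM: "A \<subseteq> space M" using sets.sets_into_space[OF A] space_F by simp
    have "Y t -` B \<inter> space M \<in> process_events M borel Y"
      unfolding process_events_def using t B by (intro sigma_sets.Basic) blast
    then have "M.prob (A \<inter> (Y t -` B \<inter> space M)) = M.prob A * M.prob (Y t -` B \<inter> space M)"
      using indep A unfolding indep_processes_def sets_F by (intro M.indep_setD)
    moreover have "(\<lambda>\<omega>. (\<omega>, Y t \<omega>)) -` (A \<times> B) \<inter> space M = A \<inter> (Y t -` B \<inter> space M)"
      using AM by auto
    moreover have "(\<lambda>\<omega>. \<omega>) -` A \<inter> space M = A" using AM by auto
    ultimately show "emeasure (distr M F (\<lambda>\<omega>. \<omega>)) A * emeasure (distr M borel (Y t)) B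
        = emeasure (distr M (F \<Otimes>\<^sub>M borel) (\<lambda>\<omega>. (\<omega>, Y t \<omega>))) (A \<times> B)"
      using emeasure_distr[OF id A] emeasure_distr[OF Y(1) B] emeasure_distr[OF pair, of "A \<times> B"] A B
      by (simp add: M.emeasure_eq_measure ennreal_mult)
  qed (auto intro: MF.sigma_finite_measure MY.sigma_finite_measure)
  have eq: "{\<omega> \<in> space M. X (Y t \<omega>) \<omega> = x} = (\<lambda>\<omega>. (\<omega>, Y t \<omega>)) -` H \<inter> space M"
    using H_iff Y(2) by auto
  show "{\<omega> \<in> space M. X (Y t \<omega>) \<omega> = x} \<in> sets M"
    unfolding eq by (rule measurable_sets[OF pair H_meas])
  define q' where "q' y = indicator {0..} y * q y" for y :: real
  have q'_meas: "q' \<in> borel_measurable borel"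
    using borel_measurable_continuous_on_indicator[OF _ q(2)] by (simp add: q'_def[abs_def])
  have q'_Y: "q' (Y t \<omega>) = q (Y t \<omega>)" for \<omega> using Y(2) by (simp add: q'_def)
  have qY_meas: "(\<lambda>\<omega>. q (Y t \<omega>)) \<in> borel_measurable M"
    using measurable_compose[OF Y(1) q'_meas] by (simp add: q'_Y)
  have H': "H \<in> sets (distr M F (\<lambda>\<omega>. \<omega>) \<Otimes>\<^sub>M distr M borel (Y t))"
    unfolding distr using H_meas by simp
  have "emeasure M {\<omega> \<in> space M. X (Y t \<omega>) \<omega> = x}
      = emeasure (distr M F (\<lambda>\<omega>. \<omega>) \<Otimes>\<^sub>M distr M borel (Y t)) H"
    unfolding distr eq by (rule emeasure_distr[OF pair H_meas, symmetric])
  also have "\<dots> = (\<integral>\<^sup>+y. emeasure (distr M F (\<lambda>\<omega>. \<omega>)) ((\<lambda>\<omega>. (\<omega>, y)) -` H) \<partial>distr M borel (Y t))"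
    by (rule emeasure_pair_measure_alt2[OF H'])
  also have "\<dots> = (\<integral>\<^sup>+\<omega>'. emeasure (distr M F (\<lambda>\<omega>. \<omega>)) ((\<lambda>\<omega>. (\<omega>, Y t \<omega>')) -` H) \<partial>M)"
    by (rule nn_integral_distr[OF Y(1)])
       (use measurable_emeasure_Pair2[OF H'] in simp)
  also have "\<dots> = (\<integral>\<^sup>+\<omega>'. ennreal (q (Y t \<omega>')) \<partial>M)"
  proof (rule nn_integral_cong)
    fix \<omega>'
    have sect: "(\<lambda>\<omega>. (\<omega>, Y t \<omega>')) -` H \<in> sets F"
      using sets_Pair2[OF H_meas] .
    have "(\<lambda>\<omega>. (\<omega>, Y t \<omega>')) -` H \<inter> space M = {\<omega> \<in> space M. X (Y t \<omega>') \<omega> = x}"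
      using H_iff Y(2) by auto
    then show "emeasure (distr M F (\<lambda>\<omega>. \<omega>)) ((\<lambda>\<omega>. (\<omega>, Y t \<omega>')) -` H) = ennreal (q (Y t \<omega>'))"
      using emeasure_distr[OF id sect] Y(2) by (simp add: q(1) M.emeasure_eq_measure)
  qed
  also have "\<dots> = ennreal (\<integral>\<omega>. q (Y t \<omega>) \<partial>M)"
    using Y(2) q(1) qY_meas
    by (intro nn_integral_eq_integral M.integrable_const_bound[where B = 1]) auto
  finally show "measure M {\<omega> \<in> space M. X (Y t \<omega>) \<omega> = x} = (\<integral>\<omega>. q (Y t \<omega>) \<partial>M)"
    using Y(2) q(1) by (simp add: M.emeasure_eq_measure integral_nonneg_AE)
qed

section \<open>The time-changed Erlang queue\<close>

text \<open>The Markov property with one conditioning time, \<open>0\<close>, identifies the law at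
  \<open>t\<close>: the initial state is almost sure, so conditioning on it has no effect.\<close>

lemma erlang_queue_transition:
  assumes M: "prob_space M" and Q: "erlang_queue M lam mu k Q" and k: "k \<ge> 1"
  obtains p where "transition_function (erlang_states k) p"
    and "\<And>i j. i \<in> erlang_states k \<Longrightarrow> j \<in> erlang_states k \<Longrightarrow>
      ((\<lambda>h. p h i j) has_real_derivative generator (erlang_states k) (erlang_rate lam mu k) i j) (at_right 0)"
    and "\<And>t x. t \<ge> 0 \<Longrightarrow> x \<in> erlang_states k \<Longrightarrow> measure M {\<omega> \<in> space M. Q t \<omega> = x} = p t (0, 0) x"
proof -
  let ?S = "erlang_states k"
  interpret M: prob_space M by (fact M)
  have ctmc: "ctmc M ?S (erlang_rate lam mu k) (0, 0) Q"
    using Q by (simp add: erlang_queue_def)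
  then obtain p where p: "transition_function ?S p"
    and deriv: "\<And>i j. i \<in> ?S \<Longrightarrow> j \<in> ?S \<Longrightarrow>
      ((\<lambda>h. p h i j) has_real_derivative generator ?S (erlang_rate lam mu k) i j) (at_right 0)"
    and markov: "\<And>(m::nat) (t::nat \<Rightarrow> real) (x::nat \<Rightarrow> nat \<times> nat).
           0 \<le> t 0 \<Longrightarrow> (\<forall>l\<le>m. t l < t (Suc l)) \<Longrightarrow> (\<forall>l\<le>Suc m. x l \<in> ?S) \<Longrightarrow>
           \<P>(\<omega> in M. \<forall>l\<le>m. Q (t l) \<omega> = x l) > 0 \<Longrightarrow>
           \<P>(\<omega> in M. Q (t (Suc m)) \<omega> = x (Suc m) \<bar> \<forall>l\<le>m. Q (t l) \<omega> = x l)
             = p (t (Suc m) - t m) (x m) (x (Suc m))"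
    unfolding ctmc_def by blast
  have start: "AE \<omega> in M. Q 0 \<omega> = (0, 0)" and meas: "\<And>t. t \<ge> 0 \<Longrightarrow> Q t \<in> measurable M (count_space ?S)"
    using ctmc by (auto simp: ctmc_def)
  have zero: "(0, 0) \<in> ?S" by (simp add: erlang_states_def)
  have sets: "{\<omega> \<in> space M. Q t \<omega> = x} \<in> sets M" if "t \<ge> 0" "x \<in> ?S" for t x
    using measurable_sets[OF meas[OF that(1)], of "{x}"] that(2) by (simp add: vimage_def Int_def conj_commute)
  have start_1: "\<P>(\<omega> in M. Q 0 \<omega> = (0, 0)) = 1"
    using start sets[OF _ zero] M.prob_Collect_eq_1 by simp
  have law: "measure M {\<omega> \<in> space M. Q t \<omega> = x} = p t (0, 0) x" if t: "t \<ge> 0" and x: "x \<in> ?S" for t x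
  proof (cases "t = 0")
    case True
    have "measure M {\<omega> \<in> space M. Q 0 \<omega> = x} = measure M {\<omega> \<in> space M. (0, 0) = x}"
      using start sets[OF _ x, of 0] by (intro M.finite_measure_eq_AE) auto
    then show ?thesis
      using True p zero x by (auto simp: transition_function_def M.prob_space)
  next
    case False
    \<comment> \<open>Only the indices \<open>0\<close> and \<open>1\<close> matter. The times have
      to increase strictly, hence the separate case \<open>t = 0\<close>.\<close>
    define ts where "ts l = real l * t" for l
    define xs where "xs l = (if l = 0 then (0, 0) else x)" for l :: nat
    have "\<P>(\<omega> in M. Q (ts (Suc 0)) \<omega> = xs (Suc 0) \<bar> \<forall>l\<le>0. Q (ts l) \<omega> = xs l)
        = p (ts (Suc 0) - ts 0) (xs 0) (xs (Suc 0))"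
      by (rule markov) (use False t x zero start_1 in \<open>auto simp: ts_def xs_def\<close>)
    then have "\<P>(\<omega> in M. Q t \<omega> = x \<and> Q 0 \<omega> = (0, 0)) = p t (0, 0) x"
      by (simp add: ts_def xs_def cond_prob_def start_1)
    moreover have "{\<omega> \<in> space M. Q t \<omega> = x \<and> Q 0 \<omega> = (0, 0)}
        = {\<omega> \<in> space M. Q t \<omega> = x} \<inter> {\<omega> \<in> space M. Q 0 \<omega> = (0, 0)}"
      by auto
    then have "\<P>(\<omega> in M. Q t \<omega> = x \<and> Q 0 \<omega> = (0, 0)) = \<P>(\<omega> in M. Q t \<omega> = x)"
      using start sets[OF t x] sets[OF _ zero, of 0] by (intro M.finite_measure_eq_AE) auto
    ultimately show ?thesis by simp
  qed
  show thesis using that[OF p deriv law] .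
qed

theorem proposition3p2:
  fixes M :: "'w measure"
    and lam mu \<alpha>1 \<alpha>2 c1 c2 z \<Theta> :: real
    and k n s :: nat
    and Q :: "real \<Rightarrow> 'w \<Rightarrow> nat \<times> nat"
    and D Y :: "real \<Rightarrow> 'w \<Rightarrow> real"
    and p :: "real \<Rightarrow> real"
  assumes "prob_space M"
    and "lam > 0" "mu > 0" "k \<ge> 1"
    and "0 < \<alpha>2" "\<alpha>2 < \<alpha>1" "\<alpha>1 < 1"
    and "c1 \<ge> 0" "c2 \<ge> 0" "c1 + c2 = 1"
    and "erlang_queue M lam mu k Q"
    and "mixed_stable_subordinator M \<alpha>1 \<alpha>2 c1 c2 D"
    and "Y = inverse_subordinator D"
    and "indep_processes M (count_space (erlang_states k)) Q borel Y"
    and "n \<ge> 1" "1 \<le> s" "s \<le> k"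
    and "p = state_probability M (time_change Q Y) n s"
    and "z > 0"
    and "\<Theta> = Theta lam mu k \<alpha>1 \<alpha>2 c1 c2 z"
  shows
    "set_integrable lborel {0..} (\<lambda>t. exp (- z * t) * p t) \<and>
     (\<lambda>i. B_const lam mu k n s i / \<Theta> ^ delta_const k n s i) summable_on UNIV \<and>
     (\<lambda>(i, m, r). C_const lam mu k n s i m r / \<Theta> ^ nu_const k n s i m r)
       summable_on (UNIV \<times> {1..} \<times> UNIV) \<and>
     (\<lambda>(i, m, r). D_const lam mu k n s i m r / \<Theta> ^ pi_const k n s i m r)
       summable_on (UNIV \<times> {1..} \<times> UNIV) \<and>
     laplace_transform p z =
       (c1 * z powr (\<alpha>1 - 1) + c2 * z powr (\<alpha>2 - 1)) *
       ((\<Sum>\<^sub>\<infinity>i. B_const lam mu k n s i / \<Theta> ^ delta_const k n s i)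
        + (\<Sum>\<^sub>\<infinity>i. \<Sum>\<^sub>\<infinity>m\<in>{1..}. \<Sum>\<^sub>\<infinity>r.
             C_const lam mu k n s i m r / \<Theta> ^ nu_const k n s i m r)
        - (\<Sum>\<^sub>\<infinity>i. \<Sum>\<^sub>\<infinity>m\<in>{1..}. \<Sum>\<^sub>\<infinity>r.
             D_const lam mu k n s i m r / \<Theta> ^ pi_const k n s i m r))"
proof -
  let ?S = "erlang_states k"
  interpret M: prob_space M by fact
  define \<kappa> where "\<kappa> = real k * mu"
  define \<phi> where "\<phi> = c1 * z powr \<alpha>1 + c2 * z powr \<alpha>2"
  have \<phi>: "\<phi> > 0"
  proof -
    have "c1 > 0 \<or> c2 > 0" using assms by linarith
    then show ?thesis using assms by (auto simp: \<phi>_def add_pos_nonneg add_nonneg_pos)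
  qed
  have \<Theta>: "\<Theta> = lam + real k * mu + \<phi>"
    using assms by (simp add: Theta_def \<phi>_def)
  have state: "(n, s) \<in> ?S" and zero: "(0, 0) \<in> ?S" and countable: "countable ?S"
    using assms by (auto simp: erlang_states_def)
  have ctmc: "ctmc M ?S (erlang_rate lam mu k) (0, 0) Q"
    using assms by (simp add: erlang_queue_def)
  then have start: "AE \<omega> in M. Q 0 \<omega> = (0, 0)"
    and Q_meas: "\<And>t. t \<ge> 0 \<Longrightarrow> Q t \<in> measurable M (count_space ?S)"
    and Q_right: "\<And>\<omega> t. \<omega> \<in> space M \<Longrightarrow> t \<ge> 0 \<Longrightarrow> eventually (\<lambda>u. Q u \<omega> = Q t \<omega>) (at_right t)"
    by (auto simp: ctmc_def)
  obtain P where P: "transition_function ?S P"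
    and deriv: "\<And>i j. i \<in> ?S \<Longrightarrow> j \<in> ?S \<Longrightarrow>
      ((\<lambda>h. P h i j) has_real_derivative generator ?S (erlang_rate lam mu k) i j) (at_right 0)"
    and law: "\<And>t x. t \<ge> 0 \<Longrightarrow> x \<in> ?S \<Longrightarrow> measure M {\<omega> \<in> space M. Q t \<omega> = x} = P t (0, 0) x"
    by (rule erlang_queue_transition[OF assms(1,11,4)]) blast
  define q where "q t = P t (0, 0) (n, s)" for t
  have q_law: "q t = measure M {\<omega> \<in> space M. Q t \<omega> = (n, s)}" if "t \<ge> 0" for t
    using law[OF that state] by (simp add: q_def)
  have q_le: "\<bar>q t\<bar> \<le> 1" if "t \<ge> 0" for t
    using q_law[OF that] by simp
  have q_cont: "continuous_on {0..} q"
    unfolding q_def by (rule erlang_transition_continuous[OF assms(2-4) P deriv zero state])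

  have D: "levy_process M D" "\<And>\<omega>. \<omega> \<in> space M \<Longrightarrow> mono_on {0..} (\<lambda>t. D t \<omega>)"
    "\<And>t. t \<ge> 0 \<Longrightarrow> M.expectation (\<lambda>\<omega>. exp (- z * D t \<omega>)) = exp (- t * \<phi>)"
    using assms(12,19) by (auto simp: mixed_stable_subordinator_def \<phi>_def)
  then have D': "\<And>t. t \<ge> 0 \<Longrightarrow> D t \<in> borel_measurable M" "AE \<omega> in M. D 0 \<omega> = 0"
    "\<And>\<omega> t. \<omega> \<in> space M \<Longrightarrow> t \<ge> 0 \<Longrightarrow> ((\<lambda>u. D u \<omega>) \<longlongrightarrow> D t \<omega>) (at_right t)"
    by (auto simp: levy_process_def)
  have Y_meas: "Y t \<in> borel_measurable M" for t
    using measurable_compose[OF measurable_Pair1' measurable_inverse_subordinator[of D M, OF D'(1) D(2)], of t]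
    by (simp add: assms(13))
  have Y_nonneg: "0 \<le> Y t \<omega>" for t \<omega>
    using inverse_subordinator_nonneg by (simp add: assms(13))
  have p: "p t = (\<integral>\<omega>. q (inverse_subordinator D t \<omega>) \<partial>M)" if t: "t \<ge> 0" for t
  proof -
    note change = prob_time_change[where t = t, OF assms(1) Q_meas Q_right Y_meas Y_nonneg assms(14)
        state t q_law q_cont]
    \<comment> \<open>The time-changed queue starts where \<open>Q\<close> starts, so the
      conditioning event in the state probability has probability \<open>1\<close>.\<close>
    have Y_0: "Y 0 \<omega> = 0" for \<omega> by (simp add: assms(13) inverse_subordinator_def)
    have zero_sets: "{\<omega> \<in> space M. Q 0 \<omega> = (0, 0)} \<in> sets M"
      using measurable_sets[OF Q_meas[of 0], of "{(0, 0)}"] zero by (simp add: vimage_def Int_def conj_commute)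
    then have "\<P>(\<omega> in M. Q 0 \<omega> = (0, 0)) = 1"
      using start M.prob_Collect_eq_1 by simp
    then have "p t = \<P>(\<omega> in M. Q (Y t \<omega>) \<omega> = (n, s) \<and> Q 0 \<omega> = (0, 0))"
      by (simp add: assms(18) state_probability_def time_change_def cond_prob_def Y_0)
    also have "{\<omega> \<in> space M. Q (Y t \<omega>) \<omega> = (n, s) \<and> Q 0 \<omega> = (0, 0)}
        = {\<omega> \<in> space M. Q (Y t \<omega>) \<omega> = (n, s)} \<inter> {\<omega> \<in> space M. Q 0 \<omega> = (0, 0)}"
      by auto
    also have "measure M \<dots> = \<P>(\<omega> in M. Q (Y t \<omega>) \<omega> = (n, s))"
      using start change(1) zero_sets by (intro M.finite_measure_eq_AE) auto
    finally show ?thesis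
      using change(2) by (simp add: assms(13))
  qed
  note laplace = laplace_transform_inverse_subordinator[OF assms(1) D'(1,2) D(2) D'(3) assms(19) \<phi> D(3) q_cont q_le]
  have integrable: "set_integrable lborel {0..} (\<lambda>t. exp (- z * t) * p t)"
    using laplace(1) by (rule set_integrable_cong[THEN iffD1, rotated -1]) (auto simp: p)
  have "laplace_transform p z = laplace_transform (\<lambda>t. \<integral>\<omega>. q (inverse_subordinator D t \<omega>) \<partial>M) z"
    unfolding laplace_transform_def by (intro set_lebesgue_integral_cong) (auto simp: p)
  then have transform: "laplace_transform p z = \<phi> / z * laplace_transform q \<phi>"
    using laplace(2) by simp
  have factor: "\<phi> / z = c1 * z powr (\<alpha>1 - 1) + c2 * z powr (\<alpha>2 - 1)"
    using assms(19) by (simp add: \<phi>_def powr_diff add_divide_distrib)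

  interpret walk: discounted_walk lam \<kappa> \<Theta> k
    by standard (use assms(2-4) \<phi> in \<open>auto simp: \<Theta> \<kappa>_def\<close>)
  define L where "L = int ((n - 1) * k + s)"
  obtain c where q_green: "laplace_transform q \<phi> = (1 + c) * walk.G L - c * walk.G (L + 1)"
    and c: "(\<lambda>m. walk.F (Suc m)) sums c"
    using erlang_resolvent[OF assms(2-4) \<phi> P deriv assms(15-17) \<Theta>]
    unfolding q_def[symmetric] \<kappa>_def[symmetric] L_def[symmetric] by blast
  have F: "(walk.F has_sum c) {1..}"
    by (rule walk.passage_has_sum_atLeast_1[OF c])

  \<comment> \<open>The state one phase above \<open>(n, s)\<close>, with index
    \<open>L + 1\<close>: if \<open>s\<close> is already \<open>k\<close>, the added phase opens a
    further customer. This is the case distinction in \<open>D_const\<close> and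
    \<open>pi_const\<close>.\<close>
  define n' s' where "n' = (if s < k then n else n + 1)" and "s' = (if s < k then s + 1 else 1)"
  have ns': "n' \<ge> 1" "1 \<le> s'" "s' \<le> k" using assms by (auto simp: n'_def s'_def)
  have L': "int ((n' - 1) * k + s') = L + 1"
  proof (cases "s < k")
    case False
    then have "s = k" using assms by simp
    moreover have "n * k = (n - 1) * k + k" using assms(15) by (cases n) auto
    ultimately show ?thesis by (simp add: n'_def s'_def L_def)
  qed (simp add: n'_def s'_def L_def)
  note B = walk.B_const_has_sum[OF assms(15-17) \<kappa>_def, folded L_def]
  note B' = walk.B_const_has_sum[OF ns' \<kappa>_def, unfolded L']
  have C_eq: "C_const lam mu k n s i m r / \<Theta> ^ nu_const k n s i m r
      = B_const lam mu k n s i / \<Theta> ^ delta_const k n s i * walk.f m r" if "m \<in> {1..}" for i m r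
    using that by (simp add: C_const_def nu_const_def \<kappa>_def passage_term_A0 power_add)
  have D_eq: "D_const lam mu k n s i m r / \<Theta> ^ pi_const k n s i m r
      = B_const lam mu k n' s' i / \<Theta> ^ delta_const k n' s' i * walk.f m r" if "m \<in> {1..}" for i m r
    using that by (simp add: D_const_def pi_const_def n'_def s'_def \<kappa>_def passage_term_A0 power_add)
  note C_sum = product_iterated_infsum[OF B(1) B(2) walk.passage_has_sum walk.passage_term_bound(1) F]
  note D_sum = product_iterated_infsum[OF B'(1) B'(2) walk.passage_has_sum walk.passage_term_bound(1) F]
  have C_summable: "(\<lambda>(i, m, r). C_const lam mu k n s i m r / \<Theta> ^ nu_const k n s i m r)
      summable_on UNIV \<times> {1..} \<times> UNIV"
    using C_sum(1) by (rule summable_on_cong[THEN iffD1, rotated]) (auto simp: C_eq)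
  have D_summable: "(\<lambda>(i, m, r). D_const lam mu k n s i m r / \<Theta> ^ pi_const k n s i m r)
      summable_on UNIV \<times> {1..} \<times> UNIV"
    using D_sum(1) by (rule summable_on_cong[THEN iffD1, rotated]) (auto simp: D_eq)
  have "(\<Sum>\<^sub>\<infinity>i. \<Sum>\<^sub>\<infinity>m\<in>{1..}. \<Sum>\<^sub>\<infinity>r. C_const lam mu k n s i m r / \<Theta> ^ nu_const k n s i m r)
      = walk.G L * c"
    unfolding C_sum(2)[symmetric] by (intro infsum_cong C_eq)
  moreover have "(\<Sum>\<^sub>\<infinity>i. \<Sum>\<^sub>\<infinity>m\<in>{1..}. \<Sum>\<^sub>\<infinity>r. D_const lam mu k n s i m r / \<Theta> ^ pi_const k n s i m r)
      = walk.G (L + 1) * c"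
    unfolding D_sum(2)[symmetric] by (intro infsum_cong D_eq)
  ultimately have "laplace_transform p z =
       (c1 * z powr (\<alpha>1 - 1) + c2 * z powr (\<alpha>2 - 1)) *
       ((\<Sum>\<^sub>\<infinity>i. B_const lam mu k n s i / \<Theta> ^ delta_const k n s i)
        + (\<Sum>\<^sub>\<infinity>i. \<Sum>\<^sub>\<infinity>m\<in>{1..}. \<Sum>\<^sub>\<infinity>r.
             C_const lam mu k n s i m r / \<Theta> ^ nu_const k n s i m r)
        - (\<Sum>\<^sub>\<infinity>i. \<Sum>\<^sub>\<infinity>m\<in>{1..}. \<Sum>\<^sub>\<infinity>r.
             D_const lam mu k n s i m r / \<Theta> ^ pi_const k n s i m r))"
    unfolding transform factor[symmetric] q_green infsumI[OF B(1)] by (simp add: algebra_simps)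
  then show ?thesis
    using integrable has_sum_imp_summable[OF B(1)] C_summable D_summable by blast
qed

end
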